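(* Let $S$ be a finite set with $q\ge 2$ elements, $X=S^{\mathbb N}$, and let $(f_n)_{n\ge 0}$ be a sequence of real-valued continuous functions on $X$ with $\sup_n\|f_n\|_\infty<\infty$. Suppose that (H1) for every $\lambda\in\mathbb R$ the limit $\phi(\lambda):=\lim_{n\to\infty}\frac1n\log Z_n(\lambda)$ exists; (H2) $\displaystyle \sup_{N\ge1}\ \sup_{x_0=y_0,\dots,x_{N-1}=y_{N-1}}\ \sum_{k=0}^{N-1}|f_k(x_k,x_{k+1},\dots)-f_k(y_k,y_{k+1},\dots)|<\infty$. Let $\psi(\lambda)=\phi(\lambda)+\log q$. Then for every $\lambda>0$, $$-\frac{\psi^*(\max\partial\psi(\lambda))}{\log q}\le \dim E(\partial\psi(\lambda))\le \mathrm{Dim}\,E(\partial\psi(\lambda))\le -\frac{\psi^*(\min\partial\psi(\lambda))}{\log q},$$ and for every $\lambda<0$, $$-\frac{\psi^*(\min\partial\psi(\lambda))}{\log q}\le \dim E(\partial\psi(\lambda))\le \mathrm{Dim}\,E(\partial\psi(\lambda))\le -\frac{\psi^*(\max\partial\psi(\lambda))}{\log q}.$$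
   Context: Points of $X$ are sequences $x=(x_n)_{n\ge0}$; $T$ is the shift $(Tx)_n=x_{n+1}$. $X$ carries the metric $d(x,y)=q^{-n}$, where $n$ is the least $k$ with $x_k\ne y_k$ (and $d(x,x)=0$). $\dim$ is Hausdorff dimension and $\mathrm{Dim}$ is packing dimension with respect to $d$. $\sigma$ is the uniform Bernoulli measure: $\sigma([x_0,\dots,x_{n-1}])=q^{-n}$ for every cylinder $[x_0,\dots,x_{n-1}]=\{y: y_k=x_k,\ 0\le k<n\}$; $\mathbb E$ is expectation with respect to $\sigma$. $S_Nf(x)=\sum_{n=0}^{N-1}f_n(T^nx)=\sum_{n=0}^{N-1}f_n(x_n,x_{n+1},\dots)$, and $Z_n(\lambda)=\mathbb E\,e^{\lambda S_nf}$. $\underline A(x)=\liminf_{N\to\infty}S_Nf(x)/N$, $\overline A(x)=\limsup_{N\to\infty}S_Nf(x)/N$, and for real $a\le b$, $E([a,b])=\{x\in X: a\le\underline A(x)\le\overline A(x)\le b\}$. For a convex function $\psi:\mathbb R\to\mathbb R$: $\partial\psi(\lambda)=\{d\in\mathbb R:\ \psi(\lambda+\eta)-\psi(\lambda)\ge d\eta\ \ \forall\eta\in\mathbb R\}$ (a compact interval), and $\psi^*(\beta)=\sup_{\alpha\in\mathbb R}(\beta\alpha-\psi(\alpha))$. The function $\phi$ in (H1) is finite and convex, hence so is $\psi$. *)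

theory Defs
  imports "HOL-Analysis.Analysis" "HOL-Probability.Probability"
begin

subsection \<open>Hausdorff and packing dimension\<close>

text \<open>
  In this section \<open>d\<close> is a metric on the whole type \<open>'a\<close>, that is, \<open>Metric_space UNIV d\<close>.
\<close>

definition diam :: "('a \<Rightarrow> 'a \<Rightarrow> real) \<Rightarrow> 'a set \<Rightarrow> ennreal" where
  "diam d U = (SUP x\<in>U. SUP y\<in>U. ennreal (d x y))"

text \<open>
  The infimum runs over countable covers by sets of diameter at most \<open>\<delta>\<close>; finite covers are
  included, since the cover may contain empty sets, which contribute \<open>0 powr s = 0\<close>.
  All diameters involved are finite, so \<open>enn2real\<close> loses nothing.
\<close>

definition hausdorff_pre :: "('a \<Rightarrow> 'a \<Rightarrow> real) \<Rightarrow> real \<Rightarrow> real \<Rightarrow> 'a set \<Rightarrow> ennreal" where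
  "hausdorff_pre d s \<delta> A =
     (INF U\<in>{U :: nat \<Rightarrow> 'a set. A \<subseteq> (\<Union>i. U i) \<and> (\<forall>i. diam d (U i) \<le> ennreal \<delta>)}.
        \<Sum>i. ennreal (enn2real (diam d (U i)) powr s))"

definition hausdorff_measure :: "('a \<Rightarrow> 'a \<Rightarrow> real) \<Rightarrow> real \<Rightarrow> 'a set \<Rightarrow> ennreal" where
  "hausdorff_measure d s A = (SUP \<delta>\<in>{0<..}. hausdorff_pre d s \<delta> A)"

text \<open>
  Only exponents \<open>s > 0\<close> are used, which avoids \<open>0 powr 0\<close> and does not change the infimum.
  The empty set has dimension 0, and the dimension is \<open>\<infinity>\<close> if no exponent qualifies.
\<close>

definition hausdorff_dim :: "('a \<Rightarrow> 'a \<Rightarrow> real) \<Rightarrow> 'a set \<Rightarrow> ereal" where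
  "hausdorff_dim d A = (INF s\<in>{s. 0 < s \<and> hausdorff_measure d s A = 0}. ereal s)"

text \<open>
  A \<open>\<delta>\<close>-packing of \<open>A\<close> is a countable family of pairwise disjoint closed balls with centres in
  \<open>A\<close> and radii in \<open>(0, \<delta>]\<close>. It is represented by its set of pairs (centre, radius), because in an
  ultrametric space a ball determines neither of the two.
\<close>

definition packings :: "('a \<Rightarrow> 'a \<Rightarrow> real) \<Rightarrow> real \<Rightarrow> 'a set \<Rightarrow> ('a \<times> real) set set" where
  "packings d \<delta> A =
     {P. P \<subseteq> A \<times> {0<..\<delta>} \<and> countable P \<and>
         disjoint_family_on (\<lambda>(x, r). Metric_space.mcball UNIV d x r) P}"

definition packing_pre :: "('a \<Rightarrow> 'a \<Rightarrow> real) \<Rightarrow> real \<Rightarrow> 'a set \<Rightarrow> ennreal" where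
  "packing_pre d s A =
     (INF \<delta>\<in>{0<..}. SUP P\<in>packings d \<delta> A. \<Sum>\<^sub>\<infinity>(x, r)\<in>P. ennreal ((2 * r) powr s))"

definition packing_measure :: "('a \<Rightarrow> 'a \<Rightarrow> real) \<Rightarrow> real \<Rightarrow> 'a set \<Rightarrow> ennreal" where
  "packing_measure d s A =
     (INF U\<in>{U :: nat \<Rightarrow> 'a set. A \<subseteq> (\<Union>i. U i)}. \<Sum>i. packing_pre d s (U i))"

definition packing_dim :: "('a \<Rightarrow> 'a \<Rightarrow> real) \<Rightarrow> 'a set \<Rightarrow> ereal" where
  "packing_dim d A = (INF s\<in>{s. 0 < s \<and> packing_measure d s A = 0}. ereal s)"


subsection \<open>The sequence space\<close>

text \<open>The finite alphabet is a type \<open>'s\<close> of class \<open>finite\<close>; \<open>q\<close> is \<open>CARD('s)\<close>.\<close>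

definition seq_dist :: "(nat \<Rightarrow> 's::finite) \<Rightarrow> (nat \<Rightarrow> 's) \<Rightarrow> real" where
  "seq_dist x y = (if x = y then 0 else 1 / real CARD('s) ^ (LEAST k. x k \<noteq> y k))"

definition seq_shift :: "(nat \<Rightarrow> 's) \<Rightarrow> nat \<Rightarrow> 's" where
  "seq_shift x = (\<lambda>n. x (Suc n))"

definition bernoulli :: "(nat \<Rightarrow> 's::finite) measure" where
  "bernoulli = PiM UNIV (\<lambda>_. uniform_count_measure UNIV)"

lemma seq_shift_funpow: "(seq_shift ^^ n) x = (\<lambda>k. x (n + k))"
  by (induction n) (auto simp: seq_shift_def)

lemma seq_dist_commute: "seq_dist x y = seq_dist y x"
  unfolding seq_dist_def by (auto simp: eq_commute)

lemma seq_dist_ultrametric: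
  "seq_dist x z \<le> max (seq_dist x y) (seq_dist (y :: nat \<Rightarrow> 's::finite) z)"
proof (cases "x = y \<or> y = z \<or> x = z")
  case True
  then show ?thesis by (auto simp: seq_dist_def le_max_iff_disj)
next
  case False
  let ?l = "\<lambda>x y :: nat \<Rightarrow> 's. LEAST k. x k \<noteq> y k"
  have "x (?l x z) \<noteq> z (?l x z)"
    using False by (intro LeastI_ex[of "\<lambda>k. x k \<noteq> z k"]) auto
  then have "x (?l x z) \<noteq> y (?l x z) \<or> y (?l x z) \<noteq> z (?l x z)"
    by metis
  then have "?l x y \<le> ?l x z \<or> ?l y z \<le> ?l x z"
    by (auto intro: Least_le)
  moreover have "1 / real CARD('s) ^ n \<le> 1 / real CARD('s) ^ m" if "m \<le> n" for m n
    using that by (intro divide_left_mono power_increasing) (auto simp: Suc_le_eq)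
  ultimately show ?thesis
    using False unfolding seq_dist_def le_max_iff_disj by auto
qed

lemma Metric_space_seq_dist: "Metric_space UNIV seq_dist"
proof
  fix x y z :: "nat \<Rightarrow> 's::finite"
  show "0 \<le> seq_dist x y" by (simp add: seq_dist_def)
  show "seq_dist x y = seq_dist y x" by (rule seq_dist_commute)
  show "seq_dist x y = 0 \<longleftrightarrow> x = y" by (simp add: seq_dist_def)
  have "0 \<le> seq_dist x y" "0 \<le> seq_dist y z" by (simp_all add: seq_dist_def)
  then show "seq_dist x z \<le> seq_dist x y + seq_dist y z"
    using seq_dist_ultrametric[of x z y] by linarith
qed

lemma prob_space_bernoulli: "prob_space (bernoulli :: (nat \<Rightarrow> 's::finite) measure)"
  unfolding bernoulli_def
  by (intro prob_space_PiM prob_space_uniform_count_measure) auto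

lemma emeasure_bernoulli_cylinder:
  "emeasure bernoulli {y. \<forall>k<n. y k = x k} =
     ennreal (1 / real CARD('s) ^ n)" for x :: "nat \<Rightarrow> 's::finite"
proof -
  let ?u = "uniform_count_measure (UNIV :: 's set)"
  interpret product_prob_space "\<lambda>_::nat. ?u" UNIV
    by (intro product_prob_spaceI prob_space_uniform_count_measure) auto
  have eq: "{y. \<forall>k<n. y k = x k} =
      {y\<in>space (PiM UNIV (\<lambda>_::nat. ?u)). \<forall>k\<in>{..<n}. y k \<in> {x k}}"
    by (auto simp: space_PiM space_uniform_count_measure)
  have "emeasure bernoulli {y. \<forall>k<n. y k = x k} = (\<Prod>k<n. emeasure ?u {x k})"
    unfolding bernoulli_def eq
    by (rule emeasure_PiM_Collect) (auto simp: sets_uniform_count_measure)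
  also have "\<dots> = (\<Prod>k<n. ennreal (1 / real CARD('s)))"
    by (simp add: emeasure_uniform_count_measure)
  also have "\<dots> = ennreal (1 / real CARD('s) ^ n)"
    by (simp add: prod_ennreal power_one_over ennreal_power)
  finally show ?thesis .
qed

definition seq_continuous :: "((nat \<Rightarrow> 's::finite) \<Rightarrow> real) \<Rightarrow> bool" where
  "seq_continuous g \<longleftrightarrow> continuous_map (Metric_space.mtopology UNIV seq_dist) euclideanreal g"


subsection \<open>Ergodic sums and level sets\<close>

definition ergodic_sum :: "(nat \<Rightarrow> (nat \<Rightarrow> 's) \<Rightarrow> real) \<Rightarrow> nat \<Rightarrow> (nat \<Rightarrow> 's) \<Rightarrow> real" where
  "ergodic_sum f N x = (\<Sum>n<N. f n ((seq_shift ^^ n) x))"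

definition partition_function ::
    "(nat \<Rightarrow> (nat \<Rightarrow> 's::finite) \<Rightarrow> real) \<Rightarrow> nat \<Rightarrow> real \<Rightarrow> real" where
  "partition_function f n t = (\<integral>x. exp (t * ergodic_sum f n x) \<partial>bernoulli)"

definition lower_avg :: "(nat \<Rightarrow> (nat \<Rightarrow> 's) \<Rightarrow> real) \<Rightarrow> (nat \<Rightarrow> 's) \<Rightarrow> ereal" where
  "lower_avg f x = liminf (\<lambda>N. ereal (ergodic_sum f N x / real N))"

definition upper_avg :: "(nat \<Rightarrow> (nat \<Rightarrow> 's) \<Rightarrow> real) \<Rightarrow> (nat \<Rightarrow> 's) \<Rightarrow> ereal" where
  "upper_avg f x = limsup (\<lambda>N. ereal (ergodic_sum f N x / real N))"

text \<open>The set written \<open>E([a, b])\<close>.\<close>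

definition level_set ::
    "(nat \<Rightarrow> (nat \<Rightarrow> 's) \<Rightarrow> real) \<Rightarrow> real \<Rightarrow> real \<Rightarrow> (nat \<Rightarrow> 's) set" where
  "level_set f a b =
     {x. ereal a \<le> lower_avg f x \<and> lower_avg f x \<le> upper_avg f x \<and> upper_avg f x \<le> ereal b}"


subsection \<open>Subdifferential and conjugate of a function on the real line\<close>

definition subdiff :: "(real \<Rightarrow> real) \<Rightarrow> real \<Rightarrow> real set" where
  "subdiff \<psi> t = {c. \<forall>h. \<psi> (t + h) - \<psi> t \<ge> c * h}"

definition subdiff_min :: "(real \<Rightarrow> real) \<Rightarrow> real \<Rightarrow> real" where
  "subdiff_min \<psi> t = (LEAST c. c \<in> subdiff \<psi> t)"

definition subdiff_max :: "(real \<Rightarrow> real) \<Rightarrow> real \<Rightarrow> real" where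
  "subdiff_max \<psi> t = (GREATEST c. c \<in> subdiff \<psi> t)"

definition conjugate :: "(real \<Rightarrow> real) \<Rightarrow> real \<Rightarrow> ereal" where
  "conjugate \<psi> \<beta> = (SUP \<alpha>. ereal (\<beta> * \<alpha> - \<psi> \<alpha>))"

text \<open>
  For convex \<open>\<psi>\<close> the subdifferential is a compact interval, so its least and greatest elements
  exist.
\<close>

lemma subdiff_eq_interval:
  assumes "convex_on UNIV \<psi>"
  shows "subdiff \<psi> t = {subdiff_min \<psi> t..subdiff_max \<psi> t} \<and> subdiff_min \<psi> t \<le> subdiff_max \<psi> t"
proof -
  let ?D = "subdiff \<psi> t"
  have eq: "?D = (\<Inter>h. {c. c * h \<le> \<psi> (t + h) - \<psi> t})"
    by (auto simp: subdiff_def)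
  have "closed ?D"
    unfolding eq by (intro closed_INT ballI closed_Collect_le continuous_intros)
  moreover have sub: "?D \<subseteq> {\<psi> t - \<psi> (t - 1)..\<psi> (t + 1) - \<psi> t}"
  proof
    fix c assume "c \<in> ?D"
    then have h: "\<psi> (t + h) - \<psi> t \<ge> c * h" for h
      by (auto simp: subdiff_def)
    from h[of 1] h[of "- 1"] show "c \<in> {\<psi> t - \<psi> (t - 1)..\<psi> (t + 1) - \<psi> t}"
      by auto
  qed
  ultimately have "compact ?D"
    using compact_Int_closed[OF compact_Icc] by (metis inf.absorb2)
  moreover obtain c where "\<And>y. \<psi> y \<ge> \<psi> t + c * (y - t)"
    using convex_le_Inf_differential[OF assms, of t] by auto
  then have "\<psi> (t + h) - \<psi> t \<ge> c * h" for h
    by (smt (verit, best) add_diff_cancel_left')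
  then have "?D \<noteq> {}"
    by (auto simp: subdiff_def)
  moreover have "connected ?D"
    unfolding connected_iff_interval
  proof (intro ballI allI impI)
    fix a b c
    assume ab: "a \<in> ?D" "b \<in> ?D" "a \<le> c" "c \<le> b"
    have "c * h \<le> max (a * h) (b * h)" for h
      using ab(3,4) by (cases "h \<ge> 0") (auto simp: le_max_iff_disj mult_right_mono mult_right_mono_neg)
    then show "c \<in> ?D"
      using ab(1,2) unfolding subdiff_def by (smt (verit, best) mem_Collect_eq)
  qed
  ultimately obtain a b where "?D = {a..b}" "a \<le> b"
    by (metis connected_compact_interval_1 atLeastatMost_empty_iff2)
  moreover from this have "subdiff_min \<psi> t = a" "subdiff_max \<psi> t = b"
    unfolding subdiff_min_def subdiff_max_def
    by (auto intro!: Least_equality Greatest_equality)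
  ultimately show ?thesis by simp
qed

end

(*
  Since f_k o T^k depends only on the coordinates from k on, (H2) makes the weights
  exp (t * S_N f(w)) of words w of length N quasi-Bernoulli: the normalised weight of a cylinder
  [x_0, ..., x_(n-1)], n <= N, agrees with exp (t * S_n f(x)) / W_n(t) up to a factor depending on t
  only, where W_n(t) is the sum of the weights of the words of length n and
  (1/n) log W_n(t) tends to psi(t).  These finite measures replace a Gibbs measure: disjoint
  cylinders have bounded total weight, and by compactness covers of X have total weight bounded
  below.  Chernoff bounds make the complement of E(subdiff psi t) null for the resulting outer
  content, so on a set of full content the weight of the n-th cylinder at x is at most
  exp (-n (psi(t) - t c - o(1))), c the appropriate endpoint of the subdifferential, which gives the
  Hausdorff bound; the reverse estimate with the other endpoint holds on all of E(subdiff psi t) and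
  gives the packing bound.
*)

theory Submission
  imports Defs
begin

subsection \<open>Words and cylinders\<close>

text \<open>Each \<open>gibbs t n\<close> is normalised at its own length, and since the f_n vary
  with n and may see infinitely many coordinates, these weights need not be consistent from one
  length to the next. Every comparison between lengths costs \<open>(distortion t)\<^sup>2\<close>:
  one factor for freezing the first n terms of the sum on a cylinder, one for replacing W_N by W_n
  times a common tail mass. Such constants disappear after dividing a logarithm by n, or are
  absorbed by an exponentially small factor. Of the outer content only two facts enter: null sets
  are stable under countable unions, and the whole space is not null. This is enough although the
  bounds on the weights at x hold only from an index depending on x, because the level set is cut
  into countably many pieces on which the index is uniform. As \<psi> may fail to be differentiable
  at t, the averages concentrate on an interval and not at a point. The exponent of the weight then
  lies between its two endpoint values, so the lower and the upper dimension bound use opposite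
  endpoints, and the sign of t decides which is which.\<close>

definition cylinder :: "nat \<Rightarrow> (nat \<Rightarrow> 's) \<Rightarrow> (nat \<Rightarrow> 's) set" where
  "cylinder n x = {y. \<forall>k<n. y k = x k}"

text \<open>Words are extensional functions, equal to \<open>undefined\<close> beyond the first
  \<open>n\<close> letters, so a word is itself a point of the sequence space at which ergodic sums
  can be evaluated. The arbitrary continuation matters only up to \<open>distortion\<close>.\<close>

definition words :: "nat \<Rightarrow> (nat \<Rightarrow> 's) set" where
  "words n = PiE {..<n} (\<lambda>_. UNIV)"

lemma self_in_cylinder [simp]: "x \<in> cylinder n x"
  by (simp add: cylinder_def)

lemma cylinder_mono: "m \<le> n \<Longrightarrow> cylinder n x \<subseteq> cylinder m x"
  by (auto simp: cylinder_def)

lemma cylinder_cong: "y \<in> cylinder n x \<Longrightarrow> cylinder n y = cylinder n x"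
  by (auto simp: cylinder_def)

lemma finite_words [simp]: "finite (words n :: (nat \<Rightarrow> 's::finite) set)"
  unfolding words_def by (intro finite_PiE) auto

lemma restrict_in_words [simp]: "restrict x {..<n} \<in> words n"
  by (simp add: words_def)

lemma restrict_in_cylinder [simp]: "restrict x {..<n} \<in> cylinder n x"
  by (simp add: cylinder_def)

lemma cylinder_restrict [simp]: "cylinder n (restrict x {..<n}) = cylinder n x"
  by (simp add: cylinder_def)

lemma words_nonempty [simp]: "words n \<noteq> {}"
  using restrict_in_words by blast

lemma restrict_eq_iff_cylinder:
  assumes "u \<in> words n"
  shows "restrict w {..<n} = u \<longleftrightarrow> w \<in> cylinder n u"
proof
  assume "w \<in> cylinder n u"
  then show "restrict w {..<n} = u"
    using assms by (intro PiE_ext[of _ "{..<n}" "\<lambda>_. UNIV"]) (auto simp: words_def cylinder_def)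
qed (auto simp: cylinder_def)

text \<open>Tychonoff: a product of finite discrete spaces is compact, and cylinders are open in
  it.\<close>

lemma finite_subcover_cylinders:
  fixes P :: "(nat \<times> (nat \<Rightarrow> 's::finite)) set"
  assumes "(\<Union>(n, x)\<in>P. cylinder n x) = UNIV"
  obtains F where "finite F" "F \<subseteq> P" "(\<Union>(n, x)\<in>F. cylinder n x) = UNIV"
proof -
  let ?X = "product_topology (\<lambda>_::nat. discrete_topology (UNIV :: 's set)) UNIV"
  have "compact_space ?X"
    by (auto simp: compact_space_product_topology compact_space_discrete_topology)
  moreover have "openin ?X (cylinder n x)" for n x
  proof -
    have eq: "cylinder n x = PiE UNIV (\<lambda>k. if k < n then {x k} else UNIV)"
      by (auto simp: cylinder_def PiE_UNIV_domain split: if_splits)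
    have "finite {k. (if k < n then {x k} else UNIV) \<noteq> (UNIV :: 's set)}"
      by (rule finite_subset[of _ "{..<n}"]) auto
    then show ?thesis
      unfolding eq by (intro product_topology_basis) auto
  qed
  moreover have "topspace ?X = UNIV"
    by auto
  ultimately have "\<exists>\<F>. finite \<F> \<and> \<F> \<subseteq> (\<lambda>(n, x). cylinder n x) ` P \<and> \<Union>\<F> = UNIV"
    using assms unfolding compact_space_alt
    by (elim allE[of _ "(\<lambda>(n, x). cylinder n x) ` P"]) (auto simp: top.extremum_unique)
  then obtain \<F> where \<F>: "finite \<F>" "\<F> \<subseteq> (\<lambda>(n, x). cylinder n x) ` P" "\<Union>\<F> = UNIV"
    by blast
  then obtain F where "F \<subseteq> P" "finite F" "\<F> = (\<lambda>(n, x). cylinder n x) ` F"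
    by (meson finite_subset_image)
  with \<F> that show thesis by blast
qed

lemma seq_dist_le_iff:
  fixes x y :: "nat \<Rightarrow> 's::finite"
  assumes q: "CARD('s) \<ge> 2"
  shows "seq_dist x y \<le> 1 / real CARD('s) ^ n \<longleftrightarrow> y \<in> cylinder n x"
proof (cases "x = y")
  case True
  then show ?thesis by (simp add: seq_dist_def)
next
  case False
  let ?l = "LEAST k. x k \<noteq> y k"
  have l: "x ?l \<noteq> y ?l"
    using False by (intro LeastI_ex[of "\<lambda>k. x k \<noteq> y k"]) auto
  have "seq_dist x y \<le> 1 / real CARD('s) ^ n \<longleftrightarrow> n \<le> ?l"
    using False q by (simp add: seq_dist_def field_simps)
  also have "\<dots> \<longleftrightarrow> (\<forall>k<n. y k = x k)"
    using l not_less_Least[of _ "\<lambda>k. x k \<noteq> y k"] by (metis le_less_trans not_le order_less_le_trans)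
  finally show ?thesis by (simp add: cylinder_def)
qed

lemma seq_dist_ge:
  fixes x y :: "nat \<Rightarrow> 's::finite"
  assumes q: "CARD('s) \<ge> 2" and "y \<notin> cylinder (Suc n) x"
  shows "seq_dist x y \<ge> 1 / real CARD('s) ^ n"
proof -
  have "x \<noteq> y" using assms(2) by auto
  have "\<not> (\<forall>k<Suc n. y k = x k)" using assms(2) by (simp add: cylinder_def)
  then obtain k where k: "k \<le> n" "x k \<noteq> y k" by (auto simp: less_Suc_eq_le)
  then have "(LEAST k. x k \<noteq> y k) \<le> n"
    by (meson Least_le le_trans)
  then show ?thesis
    using \<open>x \<noteq> y\<close> q by (simp add: seq_dist_def field_simps)
qed

section \<open>Quasi-Bernoulli estimates for the weights of words\<close>

locale bounded_distortion =
  fixes f :: "nat \<Rightarrow> (nat \<Rightarrow> 's::finite) \<Rightarrow> real" and C :: real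
  assumes card_ge: "CARD('s) \<ge> 2"
    and variation: "\<And>N x y. y \<in> cylinder N x \<Longrightarrow>
      (\<Sum>k<N. \<bar>f k ((seq_shift ^^ k) x) - f k ((seq_shift ^^ k) y)\<bar>) \<le> C"
begin

lemma C_nonneg: "C \<ge> 0"
  using variation[of undefined 0 undefined] by simp

text \<open>Up to the factor \<open>distortion t\<close> this is \<open>CARD('s) ^ n\<close> times
  the partition function; the power of the cardinality accounts for the shift from \<phi> to
  \<psi>.\<close>

definition word_sum :: "nat \<Rightarrow> real \<Rightarrow> real" where
  "word_sum n t = (\<Sum>w\<in>words n. exp (t * ergodic_sum f n w))"

text \<open>Defined at every point \<open>x\<close>, not only at words: any point may serve as the
  label of its cylinder, and another choice changes the weight by at most
  \<open>distortion t\<close>.\<close>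

definition gibbs :: "real \<Rightarrow> nat \<Rightarrow> (nat \<Rightarrow> 's) \<Rightarrow> real" where
  "gibbs t n x = exp (t * ergodic_sum f n x) / word_sum n t"

definition distortion :: "real \<Rightarrow> real" where
  "distortion t = exp (\<bar>t\<bar> * C)"

lemma distortion_ge_1: "distortion t \<ge> 1"
  using C_nonneg by (simp add: distortion_def)

lemma word_sum_pos: "word_sum n t > 0"
  unfolding word_sum_def by (intro sum_pos) auto

lemma gibbs_pos: "gibbs t n x > 0"
  by (simp add: gibbs_def word_sum_pos)

lemma sum_gibbs_words: "(\<Sum>w\<in>words n. gibbs t n w) = 1"
  using word_sum_pos[of n t] by (simp add: gibbs_def word_sum_def flip: sum_divide_distrib)

lemma ergodic_sum_distortion:
  assumes "y \<in> cylinder n x"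
  shows "\<bar>ergodic_sum f n x - ergodic_sum f n y\<bar> \<le> C"
proof -
  have "\<bar>ergodic_sum f n x - ergodic_sum f n y\<bar>
      \<le> (\<Sum>k<n. \<bar>f k ((seq_shift ^^ k) x) - f k ((seq_shift ^^ k) y)\<bar>)"
    unfolding ergodic_sum_def sum_subtractf[symmetric] by (rule sum_abs)
  also have "\<dots> \<le> C" by (rule variation[OF assms])
  finally show ?thesis .
qed

lemma exp_ergodic_sum_distortion:
  assumes "y \<in> cylinder n x"
  shows "exp (t * ergodic_sum f n y) \<le> distortion t * exp (t * ergodic_sum f n x)"
proof -
  have "t * ergodic_sum f n y - t * ergodic_sum f n x \<le> \<bar>t\<bar> * \<bar>ergodic_sum f n x - ergodic_sum f n y\<bar>"
    by (metis abs_ge_self abs_minus_commute abs_mult right_diff_distrib)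
  also have "\<dots> \<le> \<bar>t\<bar> * C"
    using ergodic_sum_distortion[OF assms] by (intro mult_left_mono) auto
  finally show ?thesis
    by (simp add: distortion_def flip: exp_add)
qed

definition tail_sum :: "nat \<Rightarrow> nat \<Rightarrow> (nat \<Rightarrow> 's) \<Rightarrow> real" where
  "tail_sum n N x = (\<Sum>k\<in>{n..<N}. f k ((seq_shift ^^ k) x))"

lemma ergodic_sum_split: "n \<le> N \<Longrightarrow> ergodic_sum f N x = ergodic_sum f n x + tail_sum n N x"
  unfolding ergodic_sum_def tail_sum_def lessThan_atLeast0
  by (subst sum.atLeastLessThan_concat) auto

lemma tail_sum_cong: "(\<And>k. k \<ge> n \<Longrightarrow> x k = y k) \<Longrightarrow> tail_sum n N x = tail_sum n N y"
  unfolding tail_sum_def by (intro sum.cong) (auto simp: seq_shift_funpow)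

text \<open>For \<open>n \<le> N\<close> the value does not depend on \<open>x\<close>, because \<open>f\<^sub>k \<circ> T\<^sup>k\<close> only sees the coordinates from \<open>k\<close> on.\<close>

definition tail_mass :: "real \<Rightarrow> nat \<Rightarrow> nat \<Rightarrow> (nat \<Rightarrow> 's) \<Rightarrow> real" where
  "tail_mass t n N x = (\<Sum>w\<in>words N \<inter> cylinder n x. exp (t * tail_sum n N w))"

lemma tail_mass_indep:
  assumes "n \<le> N"
  shows "tail_mass t n N x = tail_mass t n N y"
proof -
  \<comment> \<open>Overwriting the first \<open>n\<close> letters matches the words of length
    \<open>N\<close> extending the prefix of \<open>x\<close> with those extending the prefix of
    \<open>y\<close>, and leaves the tail sum unchanged.\<close>
  let ?g = "\<lambda>z w k. if k < n then z k else w k"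
  have inv: "?g z (?g z' w) = w" if "w \<in> cylinder n z" for z z' w :: "nat \<Rightarrow> 's"
    using that by (auto simp: cylinder_def)
  have maps: "?g z w \<in> words N \<inter> cylinder n z" if "w \<in> words N" for z w :: "nat \<Rightarrow> 's"
    using that assms by (auto simp: cylinder_def words_def PiE_iff extensional_def)
  show ?thesis
    unfolding tail_mass_def
    by (rule sum.reindex_bij_witness[of _ "?g x" "?g y"])
      (use inv maps in \<open>auto intro!: arg_cong[of _ _ "(*) t"] tail_sum_cong\<close>)
qed

text \<open>A discrete probability measure with atoms at the words of length \<open>N\<close>. It is
  exactly additive in the set, so cylinders of different lengths are compared by passing to one
  large \<open>N\<close>.\<close>

definition mass :: "real \<Rightarrow> nat \<Rightarrow> (nat \<Rightarrow> 's) set \<Rightarrow> real" where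
  "mass t N A = (\<Sum>w\<in>words N. gibbs t N w * indicator A w)"

lemma mass_cylinder_eq:
  assumes "n \<le> N"
  shows "word_sum N t * mass t N (cylinder n x) =
    (\<Sum>w\<in>words N \<inter> cylinder n x. exp (t * ergodic_sum f n w) * exp (t * tail_sum n N w))"
proof -
  have "mass t N (cylinder n x) = (\<Sum>w\<in>words N \<inter> cylinder n x. gibbs t N w)"
    unfolding mass_def by (simp add: sum_mult_indicator Int_def)
  also have "word_sum N t * \<dots> = (\<Sum>w\<in>words N \<inter> cylinder n x. exp (t * ergodic_sum f N w))"
    using word_sum_pos[of N t] by (simp add: gibbs_def flip: sum_divide_distrib)
  finally show ?thesis
    using assms by (simp add: ergodic_sum_split distrib_left exp_add)
qed

text \<open>On a cylinder of length \<open>n\<close> the first \<open>n\<close> terms are constant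
  up to \<open>distortion t\<close>, so the mass nearly factors into head and tail. The tail may be
  taken at any other point \<open>y\<close> by \<open>tail_mass_indep\<close>.\<close>

lemma mass_cylinder_le_tail:
  assumes "n \<le> N"
  shows "word_sum N t * mass t N (cylinder n x)
    \<le> distortion t * exp (t * ergodic_sum f n x) * tail_mass t n N y"
proof -
  have "word_sum N t * mass t N (cylinder n x)
      \<le> distortion t * exp (t * ergodic_sum f n x) * tail_mass t n N x"
    unfolding mass_cylinder_eq[OF assms] tail_mass_def sum_distrib_left
    by (intro sum_mono mult_right_mono exp_ergodic_sum_distortion) auto
  then show ?thesis
    by (simp add: tail_mass_indep[OF assms, of t x y])
qed

lemma tail_le_mass_cylinder:
  assumes "n \<le> N"
  shows "exp (t * ergodic_sum f n x) * tail_mass t n N y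
    \<le> distortion t * (word_sum N t * mass t N (cylinder n x))"
proof -
  have "exp (t * ergodic_sum f n x) * tail_mass t n N x
      \<le> distortion t * (word_sum N t * mass t N (cylinder n x))"
    unfolding mass_cylinder_eq[OF assms] tail_mass_def sum_distrib_left mult.assoc[symmetric]
    by (intro sum_mono mult_right_mono exp_ergodic_sum_distortion) (auto simp: cylinder_def)
  then show ?thesis
    by (simp add: tail_mass_indep[OF assms, of t x y])
qed

lemma sum_mass_cylinders:
  assumes "n \<le> N"
  shows "(\<Sum>u\<in>words n. mass t N (cylinder n u)) = 1"
proof -
  have "(\<Sum>u\<in>words n. mass t N (cylinder n u)) =
      (\<Sum>w\<in>words N. \<Sum>u\<in>words n. gibbs t N w * indicator (cylinder n u) w)"
    unfolding mass_def by (rule sum.swap)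
  also have "\<dots> = (\<Sum>w\<in>words N. gibbs t N w)"
  proof (intro sum.cong refl)
    fix w :: "nat \<Rightarrow> 's"
    have "(\<Sum>u\<in>words n. gibbs t N w * indicator (cylinder n u) w) =
        (\<Sum>u\<in>words n. if u = restrict w {..<n} then gibbs t N w else 0)"
      by (intro sum.cong refl) (auto simp flip: restrict_eq_iff_cylinder simp: indicator_def)
    then show "(\<Sum>u\<in>words n. gibbs t N w * indicator (cylinder n u) w) = gibbs t N w"
      by simp
  qed
  finally show ?thesis by (simp add: sum_gibbs_words)
qed

text \<open>The cylinder estimate is summed over all prefixes of length \<open>n\<close>; the tail
  mass, being the same for each of them, factors out.\<close>

lemma word_sum_le_tail:
  assumes "n \<le> N"
  shows "word_sum N t \<le> distortion t * (word_sum n t * tail_mass t n N y)"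
proof -
  have "word_sum N t = (\<Sum>u\<in>words n. word_sum N t * mass t N (cylinder n u))"
    using sum_mass_cylinders[OF assms] by (simp flip: sum_distrib_left)
  also have "\<dots> \<le> (\<Sum>u\<in>words n. distortion t * exp (t * ergodic_sum f n u) * tail_mass t n N y)"
    by (intro sum_mono mass_cylinder_le_tail assms)
  finally show ?thesis
    by (simp add: word_sum_def sum_distrib_left sum_distrib_right mult.assoc)
qed

lemma tail_le_word_sum:
  assumes "n \<le> N"
  shows "word_sum n t * tail_mass t n N y \<le> distortion t * word_sum N t"
proof -
  have "word_sum n t * tail_mass t n N y =
      (\<Sum>u\<in>words n. exp (t * ergodic_sum f n u) * tail_mass t n N y)"
    by (simp add: word_sum_def sum_distrib_right)
  also have "\<dots> \<le> (\<Sum>u\<in>words n. distortion t * (word_sum N t * mass t N (cylinder n u)))"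
    by (intro sum_mono tail_le_mass_cylinder assms)
  also have "\<dots> = distortion t * word_sum N t"
    using sum_mass_cylinders[OF assms] by (simp flip: sum_distrib_left)
  finally show ?thesis .
qed

text \<open>The tail mass cancels between the estimate for one cylinder and the one for the
  normalisation; each of the two contributes a factor \<open>distortion t\<close>.\<close>

lemma mass_cylinder_le_gibbs:
  assumes "n \<le> N"
  shows "mass t N (cylinder n x) \<le> (distortion t)\<^sup>2 * gibbs t n x"
proof -
  let ?V = "tail_mass t n N x" and ?e = "exp (t * ergodic_sum f n x)"
  have "word_sum n t * (word_sum N t * mass t N (cylinder n x))
      \<le> word_sum n t * (distortion t * ?e * ?V)"
    using word_sum_pos[of n t] by (intro mult_left_mono mass_cylinder_le_tail assms) auto
  also have "\<dots> = distortion t * ?e * (word_sum n t * ?V)" by simp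
  also have "\<dots> \<le> distortion t * ?e * (distortion t * word_sum N t)"
    using distortion_ge_1[of t] by (intro mult_left_mono tail_le_word_sum assms) auto
  finally have "word_sum N t * (word_sum n t * mass t N (cylinder n x))
      \<le> word_sum N t * ((distortion t)\<^sup>2 * ?e)"
    by (simp add: power2_eq_square mult_ac)
  then show ?thesis
    using word_sum_pos[of N t] word_sum_pos[of n t] by (simp add: gibbs_def field_simps)
qed

lemma gibbs_le_mass_cylinder:
  assumes "n \<le> N"
  shows "gibbs t n x \<le> (distortion t)\<^sup>2 * mass t N (cylinder n x)"
proof -
  let ?V = "tail_mass t n N x" and ?e = "exp (t * ergodic_sum f n x)"
  have "word_sum N t * ?e \<le> distortion t * (word_sum n t * ?V) * ?e"
    by (intro mult_right_mono word_sum_le_tail assms) auto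
  also have "\<dots> = distortion t * word_sum n t * (?e * ?V)" by simp
  also have "\<dots> \<le> distortion t * word_sum n t *
      (distortion t * (word_sum N t * mass t N (cylinder n x)))"
    using distortion_ge_1[of t] word_sum_pos[of n t]
    by (intro mult_left_mono tail_le_mass_cylinder assms) auto
  finally have "word_sum N t * ?e
      \<le> word_sum N t * ((distortion t)\<^sup>2 * word_sum n t * mass t N (cylinder n x))"
    by (simp add: power2_eq_square mult_ac)
  then show ?thesis
    using word_sum_pos[of N t] word_sum_pos[of n t] by (simp add: gibbs_def field_simps)
qed

text \<open>At a length \<open>N\<close> beyond all \<open>n i\<close>, each word lies in at most
  one of the cylinders, and the words have total mass 1. This is what controls packings.\<close>

lemma sum_gibbs_disjoint_le:
  assumes "finite I" and disj: "disjoint_family_on (\<lambda>i. cylinder (n i) (x i)) I"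
  shows "(\<Sum>i\<in>I. gibbs t (n i) (x i)) \<le> (distortion t)\<^sup>2"
proof -
  obtain N where N: "\<And>i. i \<in> I \<Longrightarrow> n i \<le> N"
    using finite_nat_set_iff_bounded_le[of "n ` I"] assms(1) by auto
  have "(\<Sum>i\<in>I. gibbs t (n i) (x i)) \<le> (\<Sum>i\<in>I. (distortion t)\<^sup>2 * mass t N (cylinder (n i) (x i)))"
    by (intro sum_mono gibbs_le_mass_cylinder N)
  also have "\<dots> = (distortion t)\<^sup>2 *
      (\<Sum>w\<in>words N. gibbs t N w * (\<Sum>i\<in>I. indicator (cylinder (n i) (x i)) w))"
    unfolding sum_distrib_left[symmetric] mass_def by (subst sum.swap) (simp add: sum_distrib_left)
  also have "\<dots> \<le> (distortion t)\<^sup>2 * (\<Sum>w\<in>words N. gibbs t N w * 1)"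
  proof (intro mult_left_mono sum_mono)
    fix w :: "nat \<Rightarrow> 's"
    have "(\<Sum>i\<in>I. indicator (cylinder (n i) (x i)) w) = (indicator (\<Union>i\<in>I. cylinder (n i) (x i)) w :: real)"
      by (rule indicator_UN_disjoint[OF assms(1) disj, symmetric])
    then show "(\<Sum>i\<in>I. indicator (cylinder (n i) (x i)) w) \<le> (1 :: real)"
      by (simp add: indicator_def)
  qed (auto intro: less_imp_le gibbs_pos)
  finally show ?thesis by (simp add: sum_gibbs_words)
qed

text \<open>Dual to the disjoint case: at a large common length each word is counted at least
  once.\<close>

lemma sum_gibbs_cover_ge:
  assumes "finite F" and cover: "(\<Union>(n, x)\<in>F. cylinder n x) = UNIV"
  shows "1 \<le> (distortion t)\<^sup>2 * (\<Sum>(n, x)\<in>F. gibbs t n x)"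
proof -
  obtain N where N: "\<And>p. p \<in> F \<Longrightarrow> fst p \<le> N"
    using finite_nat_set_iff_bounded_le[of "fst ` F"] assms(1) by auto
  have "1 = (\<Sum>w\<in>words N. gibbs t N w * 1)"
    by (simp add: sum_gibbs_words)
  also have "\<dots> \<le> (\<Sum>w\<in>words N. gibbs t N w * (\<Sum>p\<in>F. indicator (cylinder (fst p) (snd p)) w))"
  proof (intro sum_mono mult_left_mono)
    fix w :: "nat \<Rightarrow> 's"
    obtain p where p: "p \<in> F" "w \<in> cylinder (fst p) (snd p)"
      using cover by fastforce
    have "(1::real) = (\<Sum>p\<in>{p}. indicator (cylinder (fst p) (snd p)) w)"
      using p by simp
    also have "\<dots> \<le> (\<Sum>p\<in>F. indicator (cylinder (fst p) (snd p)) w)"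
      using p assms(1) by (intro sum_mono2) auto
    finally show "1 \<le> (\<Sum>p\<in>F. indicator (cylinder (fst p) (snd p)) w :: real)" .
  qed (auto intro: less_imp_le gibbs_pos)
  also have "\<dots> = (\<Sum>p\<in>F. mass t N (cylinder (fst p) (snd p)))"
    unfolding mass_def by (subst sum.swap) (simp add: sum_distrib_left)
  also have "\<dots> \<le> (\<Sum>p\<in>F. (distortion t)\<^sup>2 * gibbs t (fst p) (snd p))"
    by (intro sum_mono mass_cylinder_le_gibbs N)
  finally show ?thesis
    by (simp add: split_beta sum_distrib_left)
qed

end

subsection \<open>Comparison of Hausdorff and packing dimension\<close>

lemma diam_le_iff: "diam d U \<le> ennreal e \<longleftrightarrow> (\<forall>x\<in>U. \<forall>y\<in>U. ennreal (d x y) \<le> ennreal e)"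
  by (simp add: diam_def SUP_le_iff)

lemma diam_empty [simp]: "diam d {} = 0"
  by (simp add: diam_def bot_ennreal)

lemma hausdorff_pre_mono: "A \<subseteq> B \<Longrightarrow> hausdorff_pre d s \<delta> A \<le> hausdorff_pre d s \<delta> B"
  unfolding hausdorff_pre_def by (intro INF_superset_mono) auto

lemma suminf_half_ennreal:
  assumes "e \<ge> 0"
  shows "(\<Sum>i. ennreal (e * (1 / 2) ^ Suc i)) = ennreal e"
  using sums_mult[OF power_half_series, of e] assms
  by (intro suminf_ennreal_eq) auto

lemma hausdorff_pre_subadditive:
  "hausdorff_pre d s \<delta> (\<Union>i. A i) \<le> (\<Sum>i. hausdorff_pre d s \<delta> (A i))"
proof (rule ennreal_le_epsilon)
  fix e :: real
  assume fin: "(\<Sum>i. hausdorff_pre d s \<delta> (A i)) < top" and e: "0 < e"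
  let ?c = "\<lambda>V. ennreal (enn2real (diam d V) powr s)"
  have "\<exists>U. A i \<subseteq> (\<Union>j. U j) \<and> (\<forall>j. diam d (U j) \<le> ennreal \<delta>) \<and>
      (\<Sum>j. ?c (U j)) \<le> hausdorff_pre d s \<delta> (A i) + ennreal (e * (1 / 2) ^ Suc i)" for i
  proof -
    have "hausdorff_pre d s \<delta> (A i) < top"
      using fin by (rule ennreal_suminf_lessD)
    moreover have "0 < ennreal (e * (1 / 2) ^ Suc i)"
      using e by simp
    ultimately have "hausdorff_pre d s \<delta> (A i)
        < hausdorff_pre d s \<delta> (A i) + ennreal (e * (1 / 2) ^ Suc i)"
      using ennreal_add_left_cancel_less[of "hausdorff_pre d s \<delta> (A i)" 0] by simp
    then show ?thesis
      unfolding hausdorff_pre_def[of d s \<delta> "A i"] INF_less_iff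
      by (auto intro: less_imp_le)
  qed
  then obtain U where U: "\<And>i. A i \<subseteq> (\<Union>j. U i j)" "\<And>i j. diam d (U i j) \<le> ennreal \<delta>"
    "\<And>i. (\<Sum>j. ?c (U i j)) \<le> hausdorff_pre d s \<delta> (A i) + ennreal (e * (1 / 2) ^ Suc i)"
    by metis
  let ?V = "\<lambda>k. case_prod U (prod_decode k)"
  have "(\<Union>i. A i) \<subseteq> (\<Union>k. ?V k)"
  proof
    fix x assume "x \<in> (\<Union>i. A i)"
    then obtain i j where "x \<in> U i j" using U(1) by blast
    then have "x \<in> ?V (prod_encode (i, j))" by simp
    then show "x \<in> (\<Union>k. ?V k)" by (rule UN_I[OF UNIV_I])
  qed
  then have "hausdorff_pre d s \<delta> (\<Union>i. A i) \<le> (\<Sum>k. ?c (?V k))"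
    unfolding hausdorff_pre_def using U(2) by (intro INF_lower) (auto split: prod.split)
  also have "\<dots> = (\<Sum>i. \<Sum>j. ?c (U i j))"
    by (rule suminf_ennreal_2dimen[where f = "\<lambda>p. ?c (case_prod U p)"]) simp
  also have "\<dots> \<le> (\<Sum>i. hausdorff_pre d s \<delta> (A i) + ennreal (e * (1 / 2) ^ Suc i))"
    by (intro suminf_le U(3)) auto
  also have "\<dots> = (\<Sum>i. hausdorff_pre d s \<delta> (A i)) + (\<Sum>i. ennreal (e * (1 / 2) ^ Suc i))"
    by (subst suminf_add[symmetric]) auto
  also have "(\<Sum>i. ennreal (e * (1 / 2) ^ Suc i)) = ennreal e"
    using e by (intro suminf_half_ennreal) simp
  finally show "hausdorff_pre d s \<delta> (\<Union>i. A i) \<le> (\<Sum>i. hausdorff_pre d s \<delta> (A i)) + ennreal e" .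
qed

lemma hausdorff_pre_le_finite_cover:
  assumes "finite I" "A \<subseteq> (\<Union>i\<in>I. V i)" "\<And>i. i \<in> I \<Longrightarrow> diam d (V i) \<le> ennreal \<delta>"
  shows "hausdorff_pre d s \<delta> A \<le> (\<Sum>i\<in>I. ennreal (enn2real (diam d (V i)) powr s))"
proof -
  obtain h where h: "bij_betw h {0..<card I} I"
    using ex_bij_betw_nat_finite[OF assms(1)] by blast
  \<comment> \<open>The finite cover is padded to a sequence by empty sets, which cost nothing
    because \<open>0 powr s = 0\<close>.\<close>
  let ?U = "\<lambda>k. if k < card I then V (h k) else {}"
  have "A \<subseteq> (\<Union>k. ?U k)"
  proof
    fix x assume "x \<in> A"
    then obtain i where "i \<in> I" "x \<in> V i" using assms(2) by blast
    moreover from this obtain k where "k < card I" "h k = i"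
      using h unfolding bij_betw_def by (metis imageE atLeastLessThan_iff)
    ultimately have "x \<in> ?U k" by simp
    then show "x \<in> (\<Union>k. ?U k)" by (rule UN_I[OF UNIV_I])
  qed
  then have "hausdorff_pre d s \<delta> A \<le> (\<Sum>k. ennreal (enn2real (diam d (?U k)) powr s))"
    unfolding hausdorff_pre_def using assms(3) bij_betw_apply[OF h]
    by (intro INF_lower) auto
  also have "\<dots> = (\<Sum>k\<in>{0..<card I}. ennreal (enn2real (diam d (?U k)) powr s))"
    by (rule suminf_finite) auto
  also have "\<dots> = (\<Sum>k\<in>{0..<card I}. ennreal (enn2real (diam d (V (h k))) powr s))"
    by (intro sum.cong) auto
  also have "\<dots> = (\<Sum>i\<in>I. ennreal (enn2real (diam d (V i)) powr s))"
    by (rule sum.reindex_bij_betw[OF h])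
  finally show ?thesis .
qed

lemma mcball_seq_dist:
  fixes x :: "nat \<Rightarrow> 's::finite"
  assumes "CARD('s) \<ge> 2"
  shows "Metric_space.mcball UNIV seq_dist x (1 / real CARD('s) ^ n) = cylinder n x"
  by (auto simp: Metric_space.in_mcball[OF Metric_space_seq_dist] seq_dist_le_iff[OF assms])

lemma diam_cylinder_le:
  fixes x :: "nat \<Rightarrow> 's::finite"
  assumes "CARD('s) \<ge> 2"
  shows "diam seq_dist (cylinder n x) \<le> ennreal (1 / real CARD('s) ^ n)"
  unfolding diam_le_iff using cylinder_cong
  by (auto intro!: ennreal_leI simp: seq_dist_le_iff[OF assms])

lemma ex_inverse_card_power_le:
  fixes e :: real
  assumes "CARD('s::finite) \<ge> 2" "e > 0"
  shows "\<exists>n. 1 / real CARD('s) ^ n \<le> e"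
proof -
  obtain n where "(1 / real CARD('s)) ^ n < e"
    using assms real_arch_pow_inv[of e "1 / real CARD('s)"] by auto
  then show ?thesis
    by (auto simp: power_one_over intro: less_imp_le)
qed

text \<open>Fix a scale \<open>n\<close> and choose one point of \<open>A\<close> in each cylinder
  of length \<open>n\<close> that meets \<open>A\<close>. These cylinders are closed balls of radius
  \<open>1 / CARD('s) ^ n\<close>, and the same family both covers \<open>A\<close> and packs
  it.\<close>

lemma hausdorff_pre_le_packing_pre:
  fixes A :: "(nat \<Rightarrow> 's::finite) set"
  assumes q: "CARD('s) \<ge> 2" and "s > 0" "\<delta> > 0"
  shows "hausdorff_pre seq_dist s \<delta> A \<le> packing_pre seq_dist s A"
  unfolding packing_pre_def
proof (rule INF_greatest)
  fix \<delta>' :: real assume "\<delta>' \<in> {0<..}"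
  then obtain n where "1 / real CARD('s) ^ n \<le> min \<delta> \<delta>'"
    using ex_inverse_card_power_le[OF q, of "min \<delta> \<delta>'"] assms(3) by auto
  then have n: "1 / real CARD('s) ^ n \<le> \<delta>" "1 / real CARD('s) ^ n \<le> \<delta>'" by auto
  let ?r = "1 / real CARD('s) ^ n"
  define I where "I = (\<lambda>x. restrict x {..<n}) ` A"
  define c where "c = inv_into A (\<lambda>x. restrict x {..<n})"
  have I: "I \<subseteq> words n" by (auto simp: I_def)
  then have finI: "finite I" by (rule finite_subset) simp
  have c: "c w \<in> A" "restrict (c w) {..<n} = w" if "w \<in> I" for w
    using inv_into_into[of w "\<lambda>x. restrict x {..<n}" A] f_inv_into_f[of w "\<lambda>x. restrict x {..<n}" A]
      that by (simp_all only: I_def c_def)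
  have inj: "inj_on (\<lambda>w. (c w, ?r)) I"
    by (rule inj_onI) (metis c(2) prod.inject)
  define P where "P = (\<lambda>w. (c w, ?r)) ` I"
  have P: "P \<in> packings seq_dist \<delta>' A"
  proof -
    have "w = w'" if "w \<in> I" "w' \<in> I" "z \<in> cylinder n (c w)" "z \<in> cylinder n (c w')" for w w' z
    proof -
      have "restrict (c w) {..<n} = restrict (c w') {..<n}"
        using that(3,4) by (intro restrict_ext) (auto simp: cylinder_def)
      then show ?thesis using c(2) that by metis
    qed
    then have "disjoint_family_on (\<lambda>(x, r). Metric_space.mcball UNIV seq_dist x r) P"
      by (auto simp: disjoint_family_on_def P_def mcball_seq_dist[OF q])
    moreover have "P \<subseteq> A \<times> {0<..\<delta>'}" using c n(2) q by (auto simp: P_def)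
    ultimately show ?thesis
      using finI by (auto simp: packings_def P_def countable_finite)
  qed
  have "A \<subseteq> (\<Union>w\<in>I. cylinder n w)"
    by (auto simp: I_def)
  moreover have "diam seq_dist (cylinder n w) \<le> ennreal \<delta>" for w :: "nat \<Rightarrow> 's"
    using order_trans[OF diam_cylinder_le[OF q] ennreal_leI[OF n(1)]] .
  ultimately have "hausdorff_pre seq_dist s \<delta> A
      \<le> (\<Sum>w\<in>I. ennreal (enn2real (diam seq_dist (cylinder n w)) powr s))"
    using finI by (intro hausdorff_pre_le_finite_cover) auto
  \<comment> \<open>Packings measure a ball by \<open>2 * r\<close>, whereas in this ultrametric its
    diameter is at most \<open>r\<close>; the inequality goes the right way.\<close>
  also have "\<dots> \<le> (\<Sum>w\<in>I. ennreal ((2 * ?r) powr s))"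
  proof (intro sum_mono ennreal_leI powr_mono2)
    fix w :: "nat \<Rightarrow> 's"
    have "enn2real (diam seq_dist (cylinder n w)) \<le> ?r"
      using diam_cylinder_le[OF q] by (intro enn2real_leI) auto
    also have "\<dots> \<le> 2 * ?r" by (simp add: divide_right_mono)
    finally show "enn2real (diam seq_dist (cylinder n w)) \<le> 2 * ?r" .
  qed (use assms in auto)
  also have "\<dots> = (\<Sum>(x, r)\<in>P. ennreal ((2 * r) powr s))"
    unfolding P_def by (subst sum.reindex[OF inj]) simp
  also have "\<dots> = (\<Sum>\<^sub>\<infinity>(x, r)\<in>P. ennreal ((2 * r) powr s))"
    using finI by (simp add: P_def)
  also have "\<dots> \<le> (SUP P\<in>packings seq_dist \<delta>' A. \<Sum>\<^sub>\<infinity>(x, r)\<in>P. ennreal ((2 * r) powr s))"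
    using P by (rule SUP_upper)
  finally show "hausdorff_pre seq_dist s \<delta> A \<le> \<dots>" .
qed

lemma hausdorff_measure_le_packing_measure:
  fixes A :: "(nat \<Rightarrow> 's::finite) set"
  assumes q: "CARD('s) \<ge> 2" and "s > 0"
  shows "hausdorff_measure seq_dist s A \<le> packing_measure seq_dist s A"
  unfolding hausdorff_measure_def packing_measure_def
proof (intro SUP_least INF_greatest)
  fix \<delta> :: real and U :: "nat \<Rightarrow> (nat \<Rightarrow> 's) set"
  assume \<delta>: "\<delta> \<in> {0<..}" and "U \<in> {U. A \<subseteq> (\<Union>i. U i)}"
  then have "hausdorff_pre seq_dist s \<delta> A \<le> hausdorff_pre seq_dist s \<delta> (\<Union>i. U i)"
    by (intro hausdorff_pre_mono) simp
  also have "\<dots> \<le> (\<Sum>i. hausdorff_pre seq_dist s \<delta> (U i))"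
    by (rule hausdorff_pre_subadditive)
  also have "\<dots> \<le> (\<Sum>i. packing_pre seq_dist s (U i))"
    using \<delta> assms by (intro suminf_le hausdorff_pre_le_packing_pre) auto
  finally show "hausdorff_pre seq_dist s \<delta> A \<le> (\<Sum>i. packing_pre seq_dist s (U i))" .
qed

lemma hausdorff_dim_le_packing_dim:
  fixes A :: "(nat \<Rightarrow> 's::finite) set"
  assumes "CARD('s) \<ge> 2"
  shows "hausdorff_dim seq_dist A \<le> packing_dim seq_dist A"
  unfolding hausdorff_dim_def packing_dim_def
proof (intro INF_superset_mono subsetI)
  fix s assume "s \<in> {s. 0 < s \<and> packing_measure seq_dist s A = 0}"
  then show "s \<in> {s. 0 < s \<and> hausdorff_measure seq_dist s A = 0}"
    using hausdorff_measure_le_packing_measure[OF assms, of s A] by auto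
qed simp

subsection \<open>Gibbs weights and null sets\<close>

context bounded_distortion
begin

text \<open>Weighted counting measure on labelled cylinders. Regarding the total weight of a family
  as a measure gives monotonicity and countable subadditivity at once, for uncountable families
  too.\<close>

definition gibbs_weight :: "real \<Rightarrow> (nat \<times> (nat \<Rightarrow> 's)) measure" where
  "gibbs_weight t = point_measure UNIV (\<lambda>(n, x). ennreal (gibbs t n x))"

text \<open>Null sets of the outer measure generated by covers with weighted cylinders, defined for
  arbitrary sets.\<close>

definition gibbs_null :: "real \<Rightarrow> (nat \<Rightarrow> 's) set \<Rightarrow> bool" where
  "gibbs_null t A \<longleftrightarrow>
     (\<forall>e>0. \<exists>P. A \<subseteq> (\<Union>(n, x)\<in>P. cylinder n x) \<and> emeasure (gibbs_weight t) P \<le> ennreal e)"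

lemma sets_gibbs_weight [simp]: "sets (gibbs_weight t) = UNIV"
  by (simp add: gibbs_weight_def sets_point_measure)

lemma emeasure_gibbs_weight_finite:
  assumes "finite F"
  shows "emeasure (gibbs_weight t) F = ennreal (\<Sum>(n, x)\<in>F. gibbs t n x)"
proof -
  have "emeasure (gibbs_weight t) F = (\<Sum>p\<in>F. ennreal (case p of (n, x) \<Rightarrow> gibbs t n x))"
    unfolding gibbs_weight_def using assms
    by (subst emeasure_point_measure_finite2) (auto intro!: sum.cong)
  also have "\<dots> = ennreal (\<Sum>(n, x)\<in>F. gibbs t n x)"
    by (rule sum_ennreal) (auto intro: less_imp_le gibbs_pos)
  finally show ?thesis .
qed

lemma gibbs_null_subset: "gibbs_null t B \<Longrightarrow> A \<subseteq> B \<Longrightarrow> gibbs_null t A"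
  unfolding gibbs_null_def by (meson order_trans)

lemma gibbs_null_UN:
  assumes "\<And>i::nat. gibbs_null t (A i)"
  shows "gibbs_null t (\<Union>i. A i)"
  unfolding gibbs_null_def
proof (intro allI impI)
  fix e :: real assume e: "e > 0"
  have "\<exists>P. A i \<subseteq> (\<Union>(n, x)\<in>P. cylinder n x) \<and>
      emeasure (gibbs_weight t) P \<le> ennreal (e * (1 / 2) ^ Suc i)" for i
    using assms[of i] e unfolding gibbs_null_def by simp
  then obtain P where P: "\<And>i. A i \<subseteq> (\<Union>(n, x)\<in>P i. cylinder n x)"
    "\<And>i. emeasure (gibbs_weight t) (P i) \<le> ennreal (e * (1 / 2) ^ Suc i)"
    by metis
  have "(\<Union>i. A i) \<subseteq> (\<Union>(n, x)\<in>(\<Union>i. P i). cylinder n x)"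
    unfolding UN_UN_flatten by (intro UN_mono P(1)) simp
  moreover have "emeasure (gibbs_weight t) (\<Union>i. P i) \<le> (\<Sum>i. emeasure (gibbs_weight t) (P i))"
    by (rule emeasure_subadditive_countably) simp
  then have "emeasure (gibbs_weight t) (\<Union>i. P i) \<le> (\<Sum>i. ennreal (e * (1 / 2) ^ Suc i))"
    by (rule order_trans) (intro suminf_le P(2) summableI)
  then have "emeasure (gibbs_weight t) (\<Union>i. P i) \<le> ennreal e"
    using e by (simp only: suminf_half_ennreal less_imp_le)
  ultimately show "\<exists>P. (\<Union>i. A i) \<subseteq> (\<Union>(n, x)\<in>P. cylinder n x) \<and>
      emeasure (gibbs_weight t) P \<le> ennreal e"
    by blast
qed

lemma gibbs_null_Un:
  assumes "gibbs_null t A" "gibbs_null t B"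
  shows "gibbs_null t (A \<union> B)"
proof (rule gibbs_null_subset)
  show "gibbs_null t (\<Union>i::nat. if i = 0 then A else B)"
    using assms by (intro gibbs_null_UN) simp
  show "A \<union> B \<subseteq> (\<Union>i::nat. if i = 0 then A else B)"
    by (auto split: if_splits)
qed

lemma not_gibbs_null_UNIV: "\<not> gibbs_null t UNIV"
proof
  assume null: "gibbs_null t UNIV"
  \<comment> \<open>Half of the lower bound that \<open>sum_gibbs_cover_ge\<close> gives for the
    weight of any finite cover of the space.\<close>
  define e where "e = 1 / (2 * (distortion t)\<^sup>2)"
  have D: "(distortion t)\<^sup>2 > 0" using distortion_ge_1[of t] by simp
  then have "e > 0" by (simp add: e_def)
  then obtain P where P: "(\<Union>(n, x)\<in>P. cylinder n x) = (UNIV :: (nat \<Rightarrow> 's) set)"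
    "emeasure (gibbs_weight t) P \<le> ennreal e"
    using null unfolding gibbs_null_def by (meson top.extremum_unique)
  obtain F where F: "finite F" "F \<subseteq> P" "(\<Union>(n, x)\<in>F. cylinder n x) = UNIV"
    by (rule finite_subcover_cylinders[OF P(1)])
  have "ennreal (\<Sum>(n, x)\<in>F. gibbs t n x) \<le> emeasure (gibbs_weight t) P"
    using F by (simp flip: emeasure_gibbs_weight_finite add: emeasure_mono)
  with P(2) have "(\<Sum>(n, x)\<in>F. gibbs t n x) \<le> e"
    using \<open>e > 0\<close> by (meson ennreal_le_iff less_imp_le order_trans)
  then have "1 \<le> (distortion t)\<^sup>2 * e"
    using sum_gibbs_cover_ge[OF F(1,3), of t] D by (meson mult_left_mono less_imp_le order_trans)
  then show False
    using D by (simp add: e_def)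
qed

lemma gibbs_null_cover:
  assumes "\<And>e. e > 0 \<Longrightarrow> \<exists>n x. A \<subseteq> (\<Union>i. cylinder (n i) (x i)) \<and>
    (\<Sum>i. ennreal (gibbs t (n i) (x i))) \<le> ennreal e"
  shows "gibbs_null t A"
  unfolding gibbs_null_def
proof (intro allI impI)
  fix e :: real assume "e > 0"
  then obtain n x where nx: "A \<subseteq> (\<Union>i. cylinder (n i) (x i))"
    "(\<Sum>i. ennreal (gibbs t (n i) (x i))) \<le> ennreal e"
    using assms by blast
  let ?P = "\<Union>i. {(n i, x i)}"
  have "emeasure (gibbs_weight t) ?P \<le> (\<Sum>i. emeasure (gibbs_weight t) {(n i, x i)})"
    by (rule emeasure_subadditive_countably) simp
  also have "\<dots> \<le> ennreal e"
    using nx(2) by (simp add: emeasure_gibbs_weight_finite)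
  finally show "\<exists>P. A \<subseteq> (\<Union>(n, x)\<in>P. cylinder n x) \<and> emeasure (gibbs_weight t) P \<le> ennreal e"
    using nx(1) by (intro exI[of _ ?P]) auto
qed

text \<open>First Borel-Cantelli lemma: for every \<open>M\<close>, the cylinders of the words in
  \<open>B n\<close> with \<open>n \<ge> M\<close> cover the set, and their weight is bounded by a
  tail of a convergent series.\<close>

lemma gibbs_null_borel_cantelli:
  assumes B: "\<And>n. B n \<subseteq> words n" and a: "summable a"
    and le: "\<forall>\<^sub>F n in sequentially. (\<Sum>w\<in>B n. gibbs t n w) \<le> a n"
  shows "gibbs_null t {x. \<exists>\<^sub>F n in sequentially. restrict x {..<n} \<in> B n}"
  unfolding gibbs_null_def
proof (intro allI impI)
  fix e :: real assume e: "e > 0"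
  obtain M0 where M0: "\<And>n. n \<ge> M0 \<Longrightarrow> (\<Sum>w\<in>B n. gibbs t n w) \<le> a n"
    using le unfolding eventually_sequentially by blast
  obtain M1 where M1: "\<And>n. n \<ge> M1 \<Longrightarrow> norm (\<Sum>i. a (i + n)) < e"
    using suminf_exist_split[OF e a] by blast
  define M where "M = max M0 M1"
  let ?P = "\<Union>i. {i + M} \<times> B (i + M)"
  have fin: "finite (B n)" for n using B finite_subset finite_words by blast
  have nonneg: "(\<Sum>w\<in>B n. gibbs t n w) \<ge> 0" for n
    by (intro sum_nonneg less_imp_le gibbs_pos)
  have a_nonneg: "a (i + M) \<ge> 0" for i
    using order_trans[OF nonneg[of "i + M"] M0[of "i + M"]] by (simp add: M_def)
  have "emeasure (gibbs_weight t) ?P \<le> (\<Sum>i. emeasure (gibbs_weight t) ({i + M} \<times> B (i + M)))"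
    by (rule emeasure_subadditive_countably) simp
  also have "\<dots> = (\<Sum>i. ennreal (\<Sum>w\<in>B (i + M). gibbs t (i + M) w))"
    using fin by (simp add: emeasure_gibbs_weight_finite flip: sum.cartesian_product)
  also have "\<dots> \<le> (\<Sum>i. ennreal (a (i + M)))"
    by (intro suminf_le ennreal_leI M0) (auto simp: M_def)
  also have "\<dots> = ennreal (\<Sum>i. a (i + M))"
    using a a_nonneg by (intro suminf_ennreal2) auto
  also have "\<dots> \<le> ennreal e"
    using M1[of M] by (intro ennreal_leI) (auto simp: M_def)
  finally have le: "emeasure (gibbs_weight t) ?P \<le> ennreal e" .
  have "x \<in> (\<Union>(n, x)\<in>?P. cylinder n x)"
    if freq: "\<exists>\<^sub>F n in sequentially. restrict x {..<n} \<in> B n" for x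
  proof -
    obtain n where n: "n \<ge> M" "restrict x {..<n} \<in> B n"
      using freq[unfolded frequently_sequentially] by blast
    then have "(n, restrict x {..<n}) \<in> ?P"
      by (auto intro!: exI[of _ "n - M"])
    moreover have "x \<in> cylinder n (restrict x {..<n})" by simp
    ultimately show ?thesis by blast
  qed
  then show "\<exists>P. {x. \<exists>\<^sub>F n in sequentially. restrict x {..<n} \<in> B n} \<subseteq> (\<Union>(n, x)\<in>P. cylinder n x) \<and>
      emeasure (gibbs_weight t) P \<le> ennreal e"
    using le by (intro exI[of _ ?P]) auto
qed

text \<open>The smallest cylinder around a point of \<open>A \<inter> U\<close> that still contains
  \<open>U\<close> has scale at most the diameter of \<open>U\<close>, and
  \<open>h \<ge> s * ln (real CARD('s))\<close> turns its scale into a bound on its weight. The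
  slack \<open>e\<close> is for the cases without such a scale: \<open>U\<close> lies in all
  cylinders around the point, or \<open>U\<close> misses \<open>A\<close>; then a deep enough
  cylinder at a point of \<open>A\<close> will do.\<close>

lemma ex_cylinder_le_diam:
  assumes s: "s > 0" "s * ln (real CARD('s)) \<le> h"
    and A: "\<And>x n. x \<in> A \<Longrightarrow> n \<ge> M \<Longrightarrow> gibbs t n x \<le> exp (- real n * h)"
    and "A \<noteq> {}" and diam: "diam seq_dist U \<le> ennreal (1 / real CARD('s) ^ M)" and "e > 0"
  shows "\<exists>n x. A \<inter> U \<subseteq> cylinder n x \<and> gibbs t n x \<le> enn2real (diam seq_dist U) powr s + e"
proof -
  let ?q = "real CARD('s)"
  have "ln ?q > 0" using card_ge by simp
  then have h: "h > 0" using s by (meson less_le_trans mult_pos_pos)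
  have small: "\<exists>n. gibbs t n x \<le> e" if "x \<in> A" for x
  proof -
    have "(\<lambda>n. exp (- real n * h)) \<longlonglongrightarrow> 0"
      using h by real_asymp
    then have "\<forall>\<^sub>F n in sequentially. exp (- real n * h) < e"
      using \<open>e > 0\<close> by (rule order_tendstoD)
    then obtain n where "n \<ge> M" "exp (- real n * h) < e"
      unfolding eventually_sequentially by (meson max.cobounded1 max.cobounded2)
    then show ?thesis using A[OF that, of n] by (intro exI[of _ n]) simp
  qed
  show ?thesis
  proof (cases "A \<inter> U = {}")
    case True
    obtain x where "x \<in> A" using \<open>A \<noteq> {}\<close> by blast
    then obtain n where "gibbs t n x \<le> e" using small by blast
    then show ?thesis using True by (intro exI[of _ n] exI[of _ x]) (auto intro: add_increasing)
  next
    case False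
    then obtain x where x: "x \<in> A" "x \<in> U" by blast
    show ?thesis
    proof (cases "\<forall>n. U \<subseteq> cylinder n x")
      case True
      obtain n where "gibbs t n x \<le> e" using small x by blast
      then show ?thesis using True by (intro exI[of _ n] exI[of _ x]) (auto intro: add_increasing)
    next
      case False
      define L where "L = (LEAST n. \<not> U \<subseteq> cylinder n x)"
      have L: "\<not> U \<subseteq> cylinder L x"
        using LeastI_ex[of "\<lambda>n. \<not> U \<subseteq> cylinder n x"] False unfolding L_def by blast
      have below_L: "U \<subseteq> cylinder n x" if "n < L" for n
        using not_less_Least[of n "\<lambda>n. \<not> U \<subseteq> cylinder n x"] that unfolding L_def by blast
      have "y \<in> cylinder M x" if "y \<in> U" for y
      proof -
        have "ennreal (seq_dist x y) \<le> ennreal (1 / ?q ^ M)"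
          using diam x(2) that unfolding diam_le_iff by blast
        then show ?thesis by (simp add: seq_dist_le_iff[OF card_ge])
      qed
      then have "M < L"
        using L cylinder_mono[of L M x] by (meson not_le subsetI subset_trans)
      \<comment> \<open>\<open>m\<close> is the last length whose cylinder contains
        \<open>U\<close>: some point of \<open>U\<close> differs from \<open>x\<close> at a position
        at most \<open>m\<close>, which bounds the diameter from below.\<close>
      then obtain m where m: "L = Suc m" "m \<ge> M" by (cases L) auto
      obtain y where y: "y \<in> U" "y \<notin> cylinder (Suc m) x" using L m by blast
      have "1 / ?q ^ m \<le> seq_dist x y" by (rule seq_dist_ge[OF card_ge y(2)])
      also have "ennreal (seq_dist x y) \<le> diam seq_dist U"
        unfolding diam_def using x(2) y(1) by (intro SUP_upper2[of x] SUP_upper) auto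
      then have "seq_dist x y \<le> enn2real (diam seq_dist U)"
        using diam by (metis ennreal_enn2real ennreal_le_iff enn2real_nonneg ennreal_less_top order_le_less_trans)
      finally have "(1 / ?q ^ m) powr s \<le> enn2real (diam seq_dist U) powr s"
        using s card_ge by (intro powr_mono2) auto
      moreover have "gibbs t m x \<le> exp (- real m * h)" using A x(1) m(2) by blast
      moreover have "exp (- real m * h) \<le> exp (- real m * (s * ln ?q))"
        using s by (auto intro!: mult_left_mono)
      moreover have "exp (- real m * (s * ln ?q)) = (1 / ?q ^ m) powr s"
        using card_ge by (simp add: powr_def ln_div ln_realpow)
      ultimately have "gibbs t m x \<le> enn2real (diam seq_dist U) powr s + e"
        using \<open>e > 0\<close> by linarith
      moreover have "A \<inter> U \<subseteq> cylinder m x" using below_L[of m] m by auto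
      ultimately show ?thesis by blast
    qed
  qed
qed

text \<open>A form of the mass distribution principle: covers that are cheap for the Hausdorff
  measure are converted, set by set, into covers by cylinders of small weight.\<close>

lemma gibbs_null_if_hausdorff_null:
  assumes s: "s > 0" "s * ln (real CARD('s)) \<le> h"
    and A: "\<And>x n. x \<in> A \<Longrightarrow> n \<ge> M \<Longrightarrow> gibbs t n x \<le> exp (- real n * h)"
    and null: "hausdorff_measure seq_dist s A = 0"
  shows "gibbs_null t A"
proof (cases "A = {}")
  case True
  then show ?thesis unfolding gibbs_null_def by (auto intro!: exI[of _ "{}"])
next
  case False
  show ?thesis
  proof (rule gibbs_null_cover)
    fix e :: real assume e: "e > 0"
    \<comment> \<open>At this mesh the cylinders produced by \<open>ex_cylinder_le_diam\<close> have
      length at least \<open>M\<close>, where the decay of the weights on \<open>A\<close> is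
      available.\<close>
    let ?\<delta> = "1 / real CARD('s) ^ M"
    have "?\<delta> > 0" using card_ge by simp
    then have "hausdorff_pre seq_dist s ?\<delta> A \<le> hausdorff_measure seq_dist s A"
      unfolding hausdorff_measure_def by (intro SUP_upper) simp
    then have "hausdorff_pre seq_dist s ?\<delta> A < ennreal (e / 2)"
      using null e by simp
    then obtain U :: "nat \<Rightarrow> (nat \<Rightarrow> 's) set" where
      U: "A \<subseteq> (\<Union>i. U i)" "\<And>i. diam seq_dist (U i) \<le> ennreal ?\<delta>"
        "(\<Sum>i. ennreal (enn2real (diam seq_dist (U i)) powr s)) < ennreal (e / 2)"
      unfolding hausdorff_pre_def INF_less_iff by blast
    \<comment> \<open>Half of \<open>e\<close> pays for the Hausdorff sum, the other half for the
      slacks, distributed geometrically over the covering sets.\<close>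
    have "\<exists>n x. A \<inter> U i \<subseteq> cylinder n x \<and>
        gibbs t n x \<le> enn2real (diam seq_dist (U i)) powr s + e / 2 * (1 / 2) ^ Suc i" for i
      using e by (intro ex_cylinder_le_diam[OF s A False U(2)]) auto
    then obtain n x where nx: "\<And>i. A \<inter> U i \<subseteq> cylinder (n i) (x i)"
      "\<And>i. gibbs t (n i) (x i) \<le> enn2real (diam seq_dist (U i)) powr s + e / 2 * (1 / 2) ^ Suc i"
      by metis
    have "(\<Sum>i. ennreal (gibbs t (n i) (x i)))
        \<le> (\<Sum>i. ennreal (enn2real (diam seq_dist (U i)) powr s + e / 2 * (1 / 2) ^ Suc i))"
      by (intro suminf_le ennreal_leI nx(2)) auto
    also have "\<dots> = (\<Sum>i. ennreal (enn2real (diam seq_dist (U i)) powr s)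
        + ennreal (e / 2 * (1 / 2) ^ Suc i))"
      using e by (intro suminf_cong ennreal_plus) auto
    also have "\<dots> = (\<Sum>i. ennreal (enn2real (diam seq_dist (U i)) powr s))
        + (\<Sum>i. ennreal (e / 2 * (1 / 2) ^ Suc i))"
      by (subst suminf_add) auto
    also have "(\<Sum>i. ennreal (e / 2 * (1 / 2) ^ Suc i)) = ennreal (e / 2)"
      using e by (intro suminf_half_ennreal) simp
    also have "(\<Sum>i. ennreal (enn2real (diam seq_dist (U i)) powr s)) + ennreal (e / 2)
        \<le> ennreal (e / 2) + ennreal (e / 2)"
      using U(3) by (intro add_right_mono) simp
    also have "\<dots> = ennreal e"
      using e by (simp flip: ennreal_plus)
    finally have sum_le: "(\<Sum>i. ennreal (gibbs t (n i) (x i))) \<le> ennreal e" .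
    have "A \<subseteq> (\<Union>i. A \<inter> U i)" using U(1) by blast
    also have "\<dots> \<subseteq> (\<Union>i. cylinder (n i) (x i))" by (intro UN_mono nx(1)) simp
    finally show "\<exists>n x. A \<subseteq> (\<Union>i. cylinder (n i) (x i)) \<and>
        (\<Sum>i. ennreal (gibbs t (n i) (x i))) \<le> ennreal e"
      using sum_le by blast
  qed
qed

text \<open>Each ball of a packing contains a cylinder around its centre, which lies in
  \<open>A\<close>, so \<open>(2 * r) powr s\<close> is at most an exponentially small factor times
  the weight of that cylinder. The cylinders are disjoint, hence have bounded total weight.\<close>

lemma packing_pre_eq_0:
  assumes s: "s > 0" "h < s * ln (real CARD('s))"
    and A: "\<And>x n. x \<in> A \<Longrightarrow> n \<ge> M \<Longrightarrow> gibbs t n x \<ge> exp (- real n * h)"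
  shows "packing_pre seq_dist s A = 0"
proof -
  let ?q = "real CARD('s)"
  \<comment> \<open>The surplus in the exponent: \<open>(1 / ?q ^ n) powr s\<close> equals
    \<open>exp (- real n * c)\<close> times the guaranteed weight
    \<open>exp (- real n * h)\<close>.\<close>
  define c where "c = s * ln ?q - h"
  have c: "c > 0" using s by (simp add: c_def)
  have le: "packing_pre seq_dist s A \<le> ennreal e" if e: "e > 0" for e
  proof -
    have "(\<lambda>n. (2 * ?q) powr s * exp (- real n * c) * (distortion t)\<^sup>2) \<longlonglongrightarrow>
        (2 * ?q) powr s * 0 * (distortion t)\<^sup>2"
      by (intro tendsto_intros) (use c in real_asymp)
    then have "\<forall>\<^sub>F n in sequentially. (2 * ?q) powr s * exp (- real n * c) * (distortion t)\<^sup>2 < e"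
      using e by (intro order_tendstoD) auto
    then obtain n0 where n0: "n0 \<ge> M" "(2 * ?q) powr s * exp (- real n0 * c) * (distortion t)\<^sup>2 < e"
      unfolding eventually_sequentially by (meson max.cobounded1 max.cobounded2)
    have "(\<Sum>(x, r)\<in>F. ennreal ((2 * r) powr s)) \<le> ennreal e"
      if P: "P \<in> packings seq_dist (1 / ?q ^ n0) A" and F: "finite F" "F \<subseteq> P" for P F
    proof -
      \<comment> \<open>Length of the largest cylinder around the centre that is known to fit in a
        ball of radius \<open>r\<close>. Minimality gives \<open>r \<le> ?q / ?q ^ \<nu> r\<close>,
        the source of the constant \<open>(2 * ?q) powr s\<close>.\<close>
      define \<nu> where "\<nu> r = (LEAST n. 1 / ?q ^ n \<le> r)" for r
      have r: "x \<in> A" "r > 0" "r \<le> 1 / ?q ^ n0" if "(x, r) \<in> F" for x r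
        using P F(2) that by (auto simp: packings_def)
      have \<nu>: "1 / ?q ^ \<nu> r \<le> r" if "r > 0" for r
        unfolding \<nu>_def by (rule LeastI_ex) (rule ex_inverse_card_power_le[OF card_ge that])
      have \<nu>_ge: "n0 \<le> \<nu> r" if "(x, r) \<in> F" for x r
      proof -
        have "1 / ?q ^ \<nu> r \<le> 1 / ?q ^ n0" using \<nu> r that by (meson order_trans)
        then show ?thesis using card_ge by (simp add: field_simps)
      qed
      have r_le: "r \<le> ?q / ?q ^ \<nu> r" if "(x, r) \<in> F" for x r
      proof (cases "\<nu> r")
        \<comment> \<open>Minimality says nothing at length 0; here the bound comes from
          \<open>r \<le> 1\<close>.\<close>
        case 0
        have "r \<le> 1 / ?q ^ n0" using r that by blast
        also have "\<dots> \<le> 1" using card_ge by simp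
        also have "\<dots> \<le> ?q" using card_ge by simp
        finally show ?thesis using 0 by simp
      next
        case (Suc m)
        then have "\<not> 1 / ?q ^ m \<le> r" unfolding \<nu>_def by (metis lessI not_less_Least)
        then show ?thesis using Suc card_ge by simp
      qed
      have le: "(2 * r) powr s \<le> (2 * ?q) powr s * exp (- real n0 * c) * gibbs t (\<nu> r) x"
        if "(x, r) \<in> F" for x r
      proof -
        have "(2 * r) powr s \<le> (2 * ?q * (1 / ?q ^ \<nu> r)) powr s"
          using r[OF that] r_le[OF that] s by (intro powr_mono2) auto
        also have "\<dots> = (2 * ?q) powr s * (1 / ?q ^ \<nu> r) powr s"
          by (rule powr_mult)
        also have "(1 / ?q ^ \<nu> r) powr s = exp (- real (\<nu> r) * c) * exp (- real (\<nu> r) * h)"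
          using card_ge by (simp add: powr_def ln_div ln_realpow c_def algebra_simps flip: exp_add)
        also have "\<dots> \<le> exp (- real n0 * c) * gibbs t (\<nu> r) x"
          using \<nu>_ge[OF that] c n0(1) r(1)[OF that] by (intro mult_mono A) auto
        finally show ?thesis by (simp add: mult_left_mono mult.assoc)
      qed
      have disj: "disjoint_family_on (\<lambda>p. cylinder (\<nu> (snd p)) (fst p)) F"
      proof -
        have "cylinder (\<nu> r) x \<subseteq> Metric_space.mcball UNIV seq_dist x r" if "(x, r) \<in> F" for x r
          using \<nu>[of r] r[OF that] order_trans
          by (auto simp: Metric_space.in_mcball[OF Metric_space_seq_dist] simp flip: seq_dist_le_iff[OF card_ge])
        moreover have "disjoint_family_on (\<lambda>(x, r). Metric_space.mcball UNIV seq_dist x r) F"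
          using P F(2) by (auto simp: packings_def intro: disjoint_family_on_mono)
        ultimately show ?thesis
          unfolding disjoint_family_on_def by fastforce
      qed
      have "(\<Sum>(x, r)\<in>F. ennreal ((2 * r) powr s)) = ennreal (\<Sum>(x, r)\<in>F. (2 * r) powr s)"
        by (subst sum_ennreal[symmetric]) (auto intro!: sum.cong)
      also have "(\<Sum>(x, r)\<in>F. (2 * r) powr s)
          \<le> (\<Sum>p\<in>F. (2 * ?q) powr s * exp (- real n0 * c) * gibbs t (\<nu> (snd p)) (fst p))"
        using le by (intro sum_mono) auto
      also have "\<dots> \<le> (2 * ?q) powr s * exp (- real n0 * c) * (distortion t)\<^sup>2"
        unfolding sum_distrib_left[symmetric]
        by (intro mult_left_mono sum_gibbs_disjoint_le[OF F(1) disj]) auto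
      also have "\<dots> \<le> e" using n0(2) by simp
      finally show ?thesis by (simp add: ennreal_leI)
    qed
    then have "(SUP P\<in>packings seq_dist (1 / ?q ^ n0) A. \<Sum>\<^sub>\<infinity>(x, r)\<in>P. ennreal ((2 * r) powr s)) \<le> ennreal e"
      by (subst nonneg_infsum_complete) (auto intro!: SUP_least)
    then show ?thesis
      unfolding packing_pre_def using card_ge by (intro INF_lower2[of "1 / ?q ^ n0"]) auto
  qed
  have "packing_pre seq_dist s A \<le> 0"
    by (rule ennreal_le_epsilon) (simp add: le)
  then show ?thesis by simp
qed

end

subsection \<open>Pressure and large deviations\<close>

text \<open>Equality case of the Fenchel-Young inequality: for a subgradient at \<open>t\<close> the
  supremum is attained at \<open>t\<close>.\<close>

lemma conjugate_subdiff:
  assumes "c \<in> subdiff \<psi> t"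
  shows "conjugate \<psi> c = ereal (c * t - \<psi> t)"
proof (rule antisym)
  show "conjugate \<psi> c \<le> ereal (c * t - \<psi> t)"
    unfolding conjugate_def
  proof (rule SUP_least)
    fix \<alpha>
    have "c * (\<alpha> - t) \<le> \<psi> (t + (\<alpha> - t)) - \<psi> t"
      using assms unfolding subdiff_def by blast
    then show "ereal (c * \<alpha> - \<psi> \<alpha>) \<le> ereal (c * t - \<psi> t)"
      by (simp add: algebra_simps)
  qed
qed (auto simp: conjugate_def intro: SUP_upper)

lemma level_set_iff:
  "x \<in> level_set f a b \<longleftrightarrow> (\<forall>e>0.
     (\<forall>\<^sub>F n in sequentially. a - e < ergodic_sum f n x / real n) \<and>
     (\<forall>\<^sub>F n in sequentially. ergodic_sum f n x / real n < b + e))"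
proof -
  have lower: "ereal a \<le> liminf (\<lambda>n. ereal (r n)) \<longleftrightarrow> (\<forall>e>0. \<forall>\<^sub>F n in sequentially. a - e < r n)"
    for r :: "nat \<Rightarrow> real"
  proof
    assume l: "ereal a \<le> liminf (\<lambda>n. ereal (r n))"
    show "\<forall>e>0. \<forall>\<^sub>F n in sequentially. a - e < r n"
    proof (intro allI impI)
      fix e :: real assume "e > 0"
      then show "\<forall>\<^sub>F n in sequentially. a - e < r n"
        using l[unfolded le_Liminf_iff, rule_format, of "ereal (a - e)"] by simp
    qed
  next
    assume r: "\<forall>e>0. \<forall>\<^sub>F n in sequentially. a - e < r n"
    show "ereal a \<le> liminf (\<lambda>n. ereal (r n))"
      unfolding le_Liminf_iff
    proof (intro allI impI)
      fix y assume y: "y < ereal a"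
      show "\<forall>\<^sub>F n in sequentially. y < ereal (r n)"
      proof (cases y)
        case (real z)
        then have "\<forall>\<^sub>F n in sequentially. a - (a - z) < r n"
          using y r by (intro r[rule_format]) simp
        then show ?thesis using real by simp
      qed (use y in auto)
    qed
  qed
  have upper: "limsup (\<lambda>n. ereal (r n)) \<le> ereal b \<longleftrightarrow> (\<forall>e>0. \<forall>\<^sub>F n in sequentially. r n < b + e)"
    for r :: "nat \<Rightarrow> real"
  proof
    assume l: "limsup (\<lambda>n. ereal (r n)) \<le> ereal b"
    show "\<forall>e>0. \<forall>\<^sub>F n in sequentially. r n < b + e"
    proof (intro allI impI)
      fix e :: real assume "e > 0"
      then show "\<forall>\<^sub>F n in sequentially. r n < b + e"
        using l[unfolded Limsup_le_iff, rule_format, of "ereal (b + e)"] by simp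
    qed
  next
    assume r: "\<forall>e>0. \<forall>\<^sub>F n in sequentially. r n < b + e"
    show "limsup (\<lambda>n. ereal (r n)) \<le> ereal b"
      unfolding Limsup_le_iff
    proof (intro allI impI)
      fix y assume y: "y > ereal b"
      show "\<forall>\<^sub>F n in sequentially. y > ereal (r n)"
      proof (cases y)
        case (real z)
        then have "\<forall>\<^sub>F n in sequentially. r n < b + (z - b)"
          using y r by (intro r[rule_format]) simp
        then show ?thesis using real by simp
      qed (use y in auto)
    qed
  qed
  have "lower_avg f x \<le> upper_avg f x"
    unfolding lower_avg_def upper_avg_def by (intro Liminf_le_Limsup) simp
  then show ?thesis
    unfolding level_set_def lower_avg_def upper_avg_def using lower upper by auto
qed

text \<open>(H1) in terms of \<open>word_sum\<close>; \<open>word_sum_limit\<close> makes the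
  translation.\<close>

locale pressure = bounded_distortion f C
  for f :: "nat \<Rightarrow> (nat \<Rightarrow> 's::finite) \<Rightarrow> real" and C :: real +
  fixes \<psi> :: "real \<Rightarrow> real"
  assumes pressure_limit: "\<And>t. (\<lambda>n. ln (word_sum n t) / real n) \<longlonglongrightarrow> \<psi> t"
begin

text \<open>Hoelder's inequality, proved through Young's: subtracting the logarithms normalises both
  families of weights to sum 1, after which convexity of \<open>exp\<close> is applied word by
  word.\<close>

lemma ln_word_sum_convex:
  assumes u: "0 \<le> u" "u \<le> 1"
  shows "ln (word_sum n ((1 - u) * s + u * t)) \<le> (1 - u) * ln (word_sum n s) + u * ln (word_sum n t)"
proof -
  let ?g = "\<lambda>s w. s * ergodic_sum f n w - ln (word_sum n s)"
  let ?L = "(1 - u) * ln (word_sum n s) + u * ln (word_sum n t)"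
  have gibbs: "(\<Sum>w\<in>words n. exp (?g s w)) = 1" for s
    using sum_gibbs_words[of s n] word_sum_pos[of n s] by (simp add: gibbs_def exp_diff)
  have "word_sum n ((1 - u) * s + u * t) = exp ?L *
      (\<Sum>w\<in>words n. exp ((1 - u) * ?g s w + u * ?g t w))"
    unfolding word_sum_def[of n "(1 - u) * s + u * t"] sum_distrib_left exp_add[symmetric]
    by (intro sum.cong refl arg_cong[of _ _ exp]) (simp add: algebra_simps)
  also have "\<dots> \<le> exp ?L * (\<Sum>w\<in>words n. (1 - u) * exp (?g s w) + u * exp (?g t w))"
    using convex_onD[OF exp_convex u] by (intro mult_left_mono sum_mono) auto
  also have "\<dots> = exp ?L"
    by (simp add: sum.distrib gibbs flip: sum_distrib_left)
  finally have "ln (word_sum n ((1 - u) * s + u * t)) \<le> ln (exp ?L)"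
    using word_sum_pos by (subst ln_le_cancel_iff) auto
  then show ?thesis by simp
qed

lemma convex_pressure: "convex_on UNIV \<psi>"
proof (rule convex_onI)
  fix u s t :: real assume u: "0 < u" "u < 1"
  have "(\<lambda>n. (1 - u) * (ln (word_sum n s) / real n) + u * (ln (word_sum n t) / real n))
      \<longlonglongrightarrow> (1 - u) * \<psi> s + u * \<psi> t"
    by (intro tendsto_intros pressure_limit)
  moreover have "ln (word_sum n ((1 - u) * s + u * t)) / real n \<le>
      (1 - u) * (ln (word_sum n s) / real n) + u * (ln (word_sum n t) / real n)" for n
    using divide_right_mono[OF ln_word_sum_convex[of u n s t], of "real n"] u
    by (simp add: add_divide_distrib)
  ultimately have "\<psi> ((1 - u) * s + u * t) \<le> (1 - u) * \<psi> s + u * \<psi> t"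
    by (intro LIMSEQ_le[OF pressure_limit]) auto
  then show "\<psi> ((1 - u) *\<^sub>R s + u *\<^sub>R t) \<le> (1 - u) * \<psi> s + u * \<psi> t"
    by simp
qed simp

text \<open>A sum of squares of positive numbers is at most the square of their sum. Together with
  the subgradient inequality at increment \<open>t\<close> it yields
  \<open>t * c \<le> \<psi> t\<close>.\<close>

lemma pressure_double_le: "\<psi> (2 * t) \<le> 2 * \<psi> t"
proof -
  have "ln (word_sum n (2 * t)) / real n \<le> 2 * (ln (word_sum n t) / real n)" for n
  proof -
    have "word_sum n (2 * t) = (\<Sum>w\<in>words n. (exp (t * ergodic_sum f n w))\<^sup>2)"
      unfolding word_sum_def by (intro sum.cong refl) (simp only: exp_double[symmetric] mult.assoc)
    also have "\<dots> = (\<Sum>w\<in>words n. exp (t * ergodic_sum f n w) * exp (t * ergodic_sum f n w))"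
      by (simp add: power2_eq_square)
    also have "\<dots> \<le> (\<Sum>w\<in>words n. exp (t * ergodic_sum f n w) * word_sum n t)"
      unfolding word_sum_def by (intro sum_mono mult_left_mono member_le_sum) auto
    also have "\<dots> = (word_sum n t)\<^sup>2"
      by (simp add: power2_eq_square word_sum_def sum_distrib_right)
    finally have "ln (word_sum n (2 * t)) \<le> ln ((word_sum n t)\<^sup>2)"
      using word_sum_pos[of n t] word_sum_pos[of n "2 * t"] by (subst ln_le_cancel_iff) auto
    then have "ln (word_sum n (2 * t)) \<le> 2 * ln (word_sum n t)"
      using word_sum_pos[of n t] by (simp add: ln_realpow)
    from divide_right_mono[OF this, of "real n"] show ?thesis by simp
  qed
  then show ?thesis
    by (intro LIMSEQ_le[OF pressure_limit tendsto_mult_left[OF pressure_limit]]) auto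
qed

text \<open>This makes the packing dimension bound nonnegative, so that it also holds for an empty set.\<close>

lemma subdiff_mult_le:
  assumes "c \<in> subdiff \<psi> t"
  shows "t * c \<le> \<psi> t"
proof -
  have "c * t \<le> \<psi> (t + t) - \<psi> t" using assms unfolding subdiff_def by blast
  also have "\<dots> \<le> \<psi> t" using pressure_double_le[of t] unfolding mult_2 by linarith
  finally show ?thesis by (simp add: mult.commute)
qed

text \<open>Exponential Chebyshev inequality: tilting the parameter from \<open>t\<close> to
  \<open>t + h\<close> bounds the weight of the event at time \<open>n\<close> by a constant times
  \<open>exp (- real n * v) * word_sum n (t + h) / word_sum n t\<close>, which decays exponentially
  by the assumption on \<open>v\<close>. Positive \<open>h\<close> treats the upper tail, negative
  \<open>h\<close> the lower one.\<close>

lemma gibbs_null_chernoff: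
  assumes v: "\<psi> (t + h) - \<psi> t < v"
  shows "gibbs_null t {x. \<exists>\<^sub>F n in sequentially. h * ergodic_sum f n x \<ge> real n * v}"
proof -
  \<comment> \<open>The decay rate in the limit; half of it is given up to pass from the limit to
    large finite \<open>n\<close>.\<close>
  define g where "g = v - (\<psi> (t + h) - \<psi> t)"
  have g: "g > 0" using v by (simp add: g_def)
  \<comment> \<open>The slack \<open>\<bar>h\<bar> * C\<close> allows for testing the truncated word
    in place of \<open>x\<close>.\<close>
  define B where "B n = {w \<in> words n. h * ergodic_sum f n w \<ge> real n * v - \<bar>h\<bar> * C}" for n
  have dist: "\<bar>h * ergodic_sum f n x - h * ergodic_sum f n (restrict x {..<n})\<bar> \<le> \<bar>h\<bar> * C" for n x
    using ergodic_sum_distortion[OF restrict_in_cylinder, of n x]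
    by (simp add: abs_mult mult_left_mono flip: right_diff_distrib)
  have sub: "{x. \<exists>\<^sub>F n in sequentially. h * ergodic_sum f n x \<ge> real n * v}
      \<subseteq> {x. \<exists>\<^sub>F n in sequentially. restrict x {..<n} \<in> B n}"
  proof (intro Collect_mono impI)
    fix x :: "nat \<Rightarrow> 's"
    assume "\<exists>\<^sub>F n in sequentially. real n * v \<le> h * ergodic_sum f n x"
    then show "\<exists>\<^sub>F n in sequentially. restrict x {..<n} \<in> B n"
    proof (rule frequently_elim1)
      fix n assume "real n * v \<le> h * ergodic_sum f n x"
      then show "restrict x {..<n} \<in> B n"
        using dist[of n x] by (simp add: B_def)
    qed
  qed
  have "(\<lambda>n. ln (word_sum n (t + h)) / real n - ln (word_sum n t) / real n) \<longlonglongrightarrow> \<psi> (t + h) - \<psi> t"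
    by (intro tendsto_diff pressure_limit)
  then have "\<forall>\<^sub>F n in sequentially. ln (word_sum n (t + h)) / real n - ln (word_sum n t) / real n < v - g / 2"
    by (rule order_tendstoD) (use g g_def in linarith)
  then have "\<forall>\<^sub>F n in sequentially. (\<Sum>w\<in>B n. gibbs t n w) \<le> distortion h * exp (- g / 2) ^ n"
    using eventually_gt_at_top[of 0]
  proof eventually_elim
    case (elim n)
    then have "ln (word_sum n (t + h)) - ln (word_sum n t) < real n * (v - g / 2)"
      by (simp add: field_simps)
    then have "exp (ln (word_sum n (t + h)) - ln (word_sum n t)) \<le> exp (real n * (v - g / 2))"
      by simp
    then have ratio: "word_sum n (t + h) / word_sum n t \<le> exp (real n * (v - g / 2))"
      using word_sum_pos by (simp add: exp_diff)
    have "(\<Sum>w\<in>B n. gibbs t n w)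
        \<le> (\<Sum>w\<in>B n. exp (\<bar>h\<bar> * C - real n * v) * (exp ((t + h) * ergodic_sum f n w) / word_sum n t))"
    proof (rule sum_mono)
      fix w assume "w \<in> B n"
      then have "t * ergodic_sum f n w \<le> (\<bar>h\<bar> * C - real n * v) + (t + h) * ergodic_sum f n w"
        by (simp add: B_def algebra_simps)
      then have "exp (t * ergodic_sum f n w)
          \<le> exp (\<bar>h\<bar> * C - real n * v) * exp ((t + h) * ergodic_sum f n w)"
        by (simp flip: exp_add)
      then show "gibbs t n w \<le>
          exp (\<bar>h\<bar> * C - real n * v) * (exp ((t + h) * ergodic_sum f n w) / word_sum n t)"
        using word_sum_pos[of n t] by (simp add: gibbs_def divide_right_mono)
    qed
    also have "\<dots> \<le> (\<Sum>w\<in>words n. exp (\<bar>h\<bar> * C - real n * v) * (exp ((t + h) * ergodic_sum f n w) / word_sum n t))"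
      using word_sum_pos[of n t] by (intro sum_mono2) (auto simp: B_def)
    also have "\<dots> = exp (\<bar>h\<bar> * C - real n * v) * (word_sum n (t + h) / word_sum n t)"
      by (simp only: sum_distrib_left[symmetric] sum_divide_distrib[symmetric] word_sum_def[of n "t + h"])
    also have "\<dots> \<le> exp (\<bar>h\<bar> * C - real n * v) * exp (real n * (v - g / 2))"
      by (intro mult_left_mono ratio) simp
    also have "\<dots> = distortion h * exp (- g / 2) ^ n"
      by (simp add: distortion_def algebra_simps flip: exp_add exp_of_nat_mult)
    finally show ?case .
  qed
  moreover have "summable (\<lambda>n. distortion h * exp (- g / 2) ^ n)"
    using g by (intro summable_mult summable_geometric) simp
  moreover have "B n \<subseteq> words n" for n
    by (simp add: B_def)
  ultimately have "gibbs_null t {x. \<exists>\<^sub>F n in sequentially. restrict x {..<n} \<in> B n}"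
    by (intro gibbs_null_borel_cantelli)
  then show ?thesis using sub by (rule gibbs_null_subset)
qed

text \<open>Otherwise \<open>subdiff_max \<psi> t + e\<close> would be a subgradient: for
  \<open>h > 0\<close> by the negated claim, for \<open>h \<le> 0\<close> because the smaller slope
  \<open>subdiff_max \<psi> t\<close> already is one. Its mirror image below serves the left
  endpoint.\<close>

lemma ex_subdiff_max_less:
  assumes "e > 0"
  shows "\<exists>h>0. \<psi> (t + h) - \<psi> t < h * (subdiff_max \<psi> t + e)"
proof (rule ccontr)
  assume neg: "\<not> ?thesis"
  have D: "subdiff \<psi> t = {subdiff_min \<psi> t..subdiff_max \<psi> t}" "subdiff_min \<psi> t \<le> subdiff_max \<psi> t"
    using subdiff_eq_interval[OF convex_pressure] by blast+
  then have "subdiff_max \<psi> t \<in> subdiff \<psi> t" by simp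
  then have max: "\<psi> (t + h) - \<psi> t \<ge> subdiff_max \<psi> t * h" for h
    by (simp add: subdiff_def)
  have "\<psi> (t + h) - \<psi> t \<ge> (subdiff_max \<psi> t + e) * h" for h
  proof (cases "h > 0")
    case True
    then show ?thesis using neg by (force simp: mult.commute)
  next
    case False
    then have "e * h \<le> 0" using assms by (simp add: mult_le_0_iff)
    then show ?thesis using max[of h] by (simp add: distrib_right)
  qed
  then have "subdiff_max \<psi> t + e \<in> subdiff \<psi> t" by (simp add: subdiff_def)
  then show False using D assms by simp
qed

lemma ex_subdiff_min_less:
  assumes "e > 0"
  shows "\<exists>h<0. \<psi> (t + h) - \<psi> t < h * (subdiff_min \<psi> t - e)"
proof (rule ccontr)
  assume neg: "\<not> ?thesis"
  have D: "subdiff \<psi> t = {subdiff_min \<psi> t..subdiff_max \<psi> t}" "subdiff_min \<psi> t \<le> subdiff_max \<psi> t"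
    using subdiff_eq_interval[OF convex_pressure] by blast+
  then have "subdiff_min \<psi> t \<in> subdiff \<psi> t" by simp
  then have min: "\<psi> (t + h) - \<psi> t \<ge> subdiff_min \<psi> t * h" for h
    by (simp add: subdiff_def)
  have "\<psi> (t + h) - \<psi> t \<ge> (subdiff_min \<psi> t - e) * h" for h
  proof (cases "h < 0")
    case True
    then show ?thesis using neg by (force simp: mult.commute)
  next
    case False
    then have "e * h \<ge> 0" using assms by simp
    then show ?thesis using min[of h] by (simp add: left_diff_distrib)
  qed
  then have "subdiff_min \<psi> t - e \<in> subdiff \<psi> t" by (simp add: subdiff_def)
  then show False using D assms by simp
qed

text \<open>A point outside the level set overshoots one endpoint by some \<open>1 / Suc j\<close>
  infinitely often. The tilt \<open>h\<close> in the Chernoff bound is chosen for each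
  \<open>j\<close> from the failure of the shifted slope to be a subgradient.\<close>

lemma gibbs_null_compl_level_set:
  "gibbs_null t (- level_set f (subdiff_min \<psi> t) (subdiff_max \<psi> t))"
proof -
  let ?S = "\<lambda>n x. ergodic_sum f n x / real n"
  let ?A = "\<lambda>j. {x. \<exists>\<^sub>F n in sequentially. ?S n x \<le> subdiff_min \<psi> t - 1 / Suc j}"
  let ?B = "\<lambda>j. {x. \<exists>\<^sub>F n in sequentially. subdiff_max \<psi> t + 1 / Suc j \<le> ?S n x}"
  have A: "gibbs_null t (?A j)" for j
  proof -
    obtain h where h: "h < 0" "\<psi> (t + h) - \<psi> t < h * (subdiff_min \<psi> t - 1 / Suc j)"
      using ex_subdiff_min_less[of "1 / Suc j" t] by auto
    show ?thesis
    proof (rule gibbs_null_subset[OF gibbs_null_chernoff[OF h(2)]], intro Collect_mono impI)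
      fix x :: "nat \<Rightarrow> 's"
      assume "\<exists>\<^sub>F n in sequentially. ?S n x \<le> subdiff_min \<psi> t - 1 / Suc j"
      then show "\<exists>\<^sub>F n in sequentially. real n * (h * (subdiff_min \<psi> t - 1 / Suc j)) \<le> h * ergodic_sum f n x"
      proof (rule frequently_rev_mp)
        show "\<forall>\<^sub>F n in sequentially. ?S n x \<le> subdiff_min \<psi> t - 1 / Suc j \<longrightarrow>
            real n * (h * (subdiff_min \<psi> t - 1 / Suc j)) \<le> h * ergodic_sum f n x"
          using eventually_gt_at_top[of 0]
        proof (eventually_elim, intro impI)
          fix n :: nat assume "0 < n" "?S n x \<le> subdiff_min \<psi> t - 1 / Suc j"
          then have "ergodic_sum f n x \<le> real n * (subdiff_min \<psi> t - 1 / Suc j)"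
            by (simp add: pos_divide_le_eq mult.commute)
          from mult_left_mono_neg[OF this, of h] h(1)
          show "real n * (h * (subdiff_min \<psi> t - 1 / Suc j)) \<le> h * ergodic_sum f n x"
            by (simp add: mult.left_commute)
        qed
      qed
    qed
  qed
  have B: "gibbs_null t (?B j)" for j
  proof -
    obtain h where h: "h > 0" "\<psi> (t + h) - \<psi> t < h * (subdiff_max \<psi> t + 1 / Suc j)"
      using ex_subdiff_max_less[of "1 / Suc j" t] by auto
    show ?thesis
    proof (rule gibbs_null_subset[OF gibbs_null_chernoff[OF h(2)]], intro Collect_mono impI)
      fix x :: "nat \<Rightarrow> 's"
      assume "\<exists>\<^sub>F n in sequentially. subdiff_max \<psi> t + 1 / Suc j \<le> ?S n x"
      then show "\<exists>\<^sub>F n in sequentially. real n * (h * (subdiff_max \<psi> t + 1 / Suc j)) \<le> h * ergodic_sum f n x"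
      proof (rule frequently_rev_mp)
        show "\<forall>\<^sub>F n in sequentially. subdiff_max \<psi> t + 1 / Suc j \<le> ?S n x \<longrightarrow>
            real n * (h * (subdiff_max \<psi> t + 1 / Suc j)) \<le> h * ergodic_sum f n x"
          using eventually_gt_at_top[of 0]
        proof (eventually_elim, intro impI)
          fix n :: nat assume "0 < n" "subdiff_max \<psi> t + 1 / Suc j \<le> ?S n x"
          then have "real n * (subdiff_max \<psi> t + 1 / Suc j) \<le> ergodic_sum f n x"
            by (simp add: pos_le_divide_eq mult.commute)
          from mult_left_mono[OF this, of h] h(1)
          show "real n * (h * (subdiff_max \<psi> t + 1 / Suc j)) \<le> h * ergodic_sum f n x"
            by (simp add: mult.left_commute)
        qed
      qed
    qed
  qed
  have "x \<in> level_set f (subdiff_min \<psi> t) (subdiff_max \<psi> t)"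
    if x: "x \<notin> (\<Union>j. ?A j \<union> ?B j)" for x
    unfolding level_set_iff
  proof (intro allI impI)
    fix e :: real assume "e > 0"
    then obtain j where j: "1 / Suc j < e"
      using reals_Archimedean by (metis inverse_eq_divide)
    have "\<forall>\<^sub>F n in sequentially. \<not> ?S n x \<le> subdiff_min \<psi> t - 1 / Suc j"
      "\<forall>\<^sub>F n in sequentially. \<not> subdiff_max \<psi> t + 1 / Suc j \<le> ?S n x"
      using x by (simp_all add: not_frequently)
    then have "\<forall>\<^sub>F n in sequentially. subdiff_min \<psi> t - e < ?S n x"
      "\<forall>\<^sub>F n in sequentially. ?S n x < subdiff_max \<psi> t + e"
      by (eventually_elim, use j in linarith)+
    then show "(\<forall>\<^sub>F n in sequentially. subdiff_min \<psi> t - e < ?S n x) \<and>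
        (\<forall>\<^sub>F n in sequentially. ?S n x < subdiff_max \<psi> t + e)"
      by blast
  qed
  then have "- level_set f (subdiff_min \<psi> t) (subdiff_max \<psi> t) \<subseteq> (\<Union>j. ?A j \<union> ?B j)"
    by blast
  moreover have "gibbs_null t (\<Union>j. ?A j \<union> ?B j)"
    by (intro gibbs_null_UN gibbs_null_Un A B)
  ultimately show ?thesis by (rule gibbs_null_subset[rotated])
qed

section \<open>Growth of the weights along points of the level set, and the dimension bounds\<close>

lemma ln_gibbs: "ln (gibbs t n x) = t * ergodic_sum f n x - ln (word_sum n t)"
  using word_sum_pos[of n t] by (simp add: gibbs_def ln_div)

text \<open>The hypothesis concerns \<open>t * ergodic_sum f n x\<close>, not the ergodic sum alone,
  so that both signs of \<open>t\<close> are covered, \<open>c\<close> being whichever endpoint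
  minimises \<open>t * c\<close>.\<close>

lemma eventually_gibbs_ge:
  assumes x: "\<And>e. e > 0 \<Longrightarrow> \<forall>\<^sub>F n in sequentially. t * c - e < t * ergodic_sum f n x / real n"
    and h: "\<psi> t - t * c < h"
  shows "\<forall>\<^sub>F n in sequentially. gibbs t n x \<ge> exp (- real n * h)"
proof -
  define e where "e = (h - (\<psi> t - t * c)) / 2"
  have e: "e > 0" "h = \<psi> t - t * c + 2 * e" using h by (simp_all add: e_def field_simps)
  have "\<forall>\<^sub>F n in sequentially. ln (word_sum n t) / real n < \<psi> t + e"
    using e by (intro order_tendstoD[OF pressure_limit]) auto
  then show ?thesis
    using x[OF e(1)] eventually_gt_at_top[of 0]
  proof eventually_elim
    case (elim n)
    then have "- h < t * ergodic_sum f n x / real n - ln (word_sum n t) / real n"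
      using e(2) by linarith
    also have "\<dots> = ln (gibbs t n x) / real n"
      by (simp add: ln_gibbs diff_divide_distrib)
    finally have "- real n * h \<le> ln (gibbs t n x)"
      using elim(3) by (simp add: pos_less_divide_eq mult.commute)
    then show ?case
      by (metis exp_le_cancel_iff exp_ln gibbs_pos)
  qed
qed

lemma eventually_gibbs_le:
  assumes x: "\<And>e. e > 0 \<Longrightarrow> \<forall>\<^sub>F n in sequentially. t * ergodic_sum f n x / real n < t * c + e"
    and h: "h < \<psi> t - t * c"
  shows "\<forall>\<^sub>F n in sequentially. gibbs t n x \<le> exp (- real n * h)"
proof -
  define e where "e = ((\<psi> t - t * c) - h) / 2"
  have e: "e > 0" "h = \<psi> t - t * c - 2 * e" using h by (simp_all add: e_def field_simps)
  have "\<forall>\<^sub>F n in sequentially. \<psi> t - e < ln (word_sum n t) / real n"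
    using e by (intro order_tendstoD[OF pressure_limit]) auto
  then show ?thesis
    using x[OF e(1)] eventually_gt_at_top[of 0]
  proof eventually_elim
    case (elim n)
    have "ln (gibbs t n x) / real n = t * ergodic_sum f n x / real n - ln (word_sum n t) / real n"
      by (simp add: ln_gibbs diff_divide_distrib)
    also have "\<dots> < - h"
      using e(2) elim by linarith
    finally have "ln (gibbs t n x) \<le> - real n * h"
      using elim(3) by (simp add: pos_divide_less_eq mult.commute)
    then show ?case
      by (metis exp_le_cancel_iff exp_ln gibbs_pos)
  qed
qed

text \<open>If \<open>E\<close> were Hausdorff-null for an exponent below the bound, each piece of
  \<open>E\<close> on which the decay holds from a fixed index \<open>M\<close> would be null for
  the weights; with \<open>- E\<close> these pieces exhaust the space, which is not null.\<close>

lemma hausdorff_dim_ge: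
  assumes null: "gibbs_null t (- E)"
    and E: "\<And>x e. x \<in> E \<Longrightarrow> e > 0 \<Longrightarrow>
      \<forall>\<^sub>F n in sequentially. t * ergodic_sum f n x / real n < t * c + e"
  shows "ereal ((\<psi> t - t * c) / ln (real CARD('s))) \<le> hausdorff_dim seq_dist E"
  unfolding hausdorff_dim_def
proof (rule INF_greatest, clarify)
  fix s :: real assume s: "0 < s" and E0: "hausdorff_measure seq_dist s E = 0"
  let ?q = "real CARD('s)"
  have q: "ln ?q > 0" using card_ge by simp
  show "ereal ((\<psi> t - t * c) / ln ?q) \<le> ereal s"
  proof (rule ccontr)
    assume "\<not> ?thesis"
    then have h: "s * ln ?q < \<psi> t - t * c" using q by (simp add: field_simps)
    let ?A = "\<lambda>M. {x \<in> E. \<forall>n\<ge>M. gibbs t n x \<le> exp (- real n * (s * ln ?q))}"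
    have "gibbs_null t (?A M)" for M
    proof (rule gibbs_null_if_hausdorff_null[OF s order_refl])
      have "hausdorff_measure seq_dist s (?A M) \<le> hausdorff_measure seq_dist s E"
        unfolding hausdorff_measure_def by (intro SUP_mono') (auto intro: hausdorff_pre_mono)
      then show "hausdorff_measure seq_dist s (?A M) = 0" using E0 by simp
    qed auto
    then have "gibbs_null t ((\<Union>M. ?A M) \<union> - E)"
      by (intro gibbs_null_Un gibbs_null_UN null)
    moreover have "(\<Union>M. ?A M) \<union> - E = UNIV"
      using eventually_gibbs_le[OF E h] by (auto simp: eventually_sequentially)
    ultimately show False using not_gibbs_null_UNIV by metis
  qed
qed

text \<open>The pieces with a uniform index \<open>M\<close> form a countable cover as in the
  definition of \<open>packing_measure\<close>, so it suffices that \<open>packing_pre\<close>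
  vanishes on each of them.\<close>

lemma packing_dim_le:
  assumes nonneg: "t * c \<le> \<psi> t"
    and E: "\<And>x e. x \<in> E \<Longrightarrow> e > 0 \<Longrightarrow>
      \<forall>\<^sub>F n in sequentially. t * c - e < t * ergodic_sum f n x / real n"
  shows "packing_dim seq_dist E \<le> ereal ((\<psi> t - t * c) / ln (real CARD('s)))"
proof -
  let ?q = "real CARD('s)"
  have q: "ln ?q > 0" using card_ge by simp
  have le: "packing_dim seq_dist E \<le> ereal s" if s: "(\<psi> t - t * c) / ln ?q < s" for s
  proof -
    have "0 \<le> (\<psi> t - t * c) / ln ?q" using nonneg q by simp
    \<comment> \<open>Only positive exponents enter \<open>packing_dim\<close>; this is where
      \<open>nonneg\<close> is used.\<close>
    then have "s > 0" using s by linarith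
    have "\<psi> t - t * c < s * ln ?q" using s q by (simp add: field_simps)
    then obtain h where h: "\<psi> t - t * c < h" "h < s * ln ?q" using dense by blast
    let ?A = "\<lambda>M. {x. \<forall>n\<ge>M. gibbs t n x \<ge> exp (- real n * h)}"
    have "packing_pre seq_dist s (?A M) = 0" for M
      by (rule packing_pre_eq_0[OF \<open>s > 0\<close> h(2)]) auto
    moreover have "E \<subseteq> (\<Union>M. ?A M)"
      using eventually_gibbs_ge[OF E h(1)] by (auto simp: eventually_sequentially)
    ultimately have "packing_measure seq_dist s E \<le> 0"
      unfolding packing_measure_def by (intro INF_lower2[of ?A]) auto
    then show ?thesis
      unfolding packing_dim_def using \<open>s > 0\<close> by (intro INF_lower) simp
  qed
  show ?thesis
  proof (rule dense_ge)
    fix y assume y: "ereal ((\<psi> t - t * c) / ln ?q) < y"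
    show "packing_dim seq_dist E \<le> y"
      using y le by (cases y) auto
  qed
qed

end

subsection \<open>Partition functions and the level sets\<close>

lemma seq_continuous_tendsto:
  fixes g :: "(nat \<Rightarrow> 's::finite) \<Rightarrow> real"
  assumes q: "CARD('s) \<ge> 2" and g: "seq_continuous g"
    and y: "\<And>m. \<forall>\<^sub>F n in F. y n \<in> cylinder m x"
  shows "((\<lambda>n. g (y n)) \<longlongrightarrow> g x) F"
proof -
  have "limitin (Metric_space.mtopology UNIV seq_dist) y x F"
    unfolding Metric_space.limitin_metric[OF Metric_space_seq_dist]
  proof (intro conjI allI impI)
    fix e :: real assume "e > 0"
    then obtain m where m: "1 / real CARD('s) ^ m \<le> e / 2"
      using ex_inverse_card_power_le[OF q, of "e / 2"] by auto
    from y[of m] show "\<forall>\<^sub>F n in F. y n \<in> UNIV \<and> seq_dist (y n) x < e"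
    proof eventually_elim
      case (elim n)
      then have "seq_dist x (y n) \<le> e / 2"
        using m seq_dist_le_iff[OF q] order_trans by blast
      then show ?case using \<open>e > 0\<close> by (simp add: seq_dist_commute)
    qed
  qed simp
  then have "limitin euclideanreal (g \<circ> y) (g x) F"
    using g unfolding seq_continuous_def by (rule continuous_map_limit[rotated])
  then show ?thesis by (simp add: o_def)
qed

text \<open>A non-measurable set has \<open>emeasure\<close> 0 by convention, whereas the formula
  for cylinders gives a positive value.\<close>

lemma sets_bernoulli_cylinder [simp]:
  fixes x :: "nat \<Rightarrow> 's::finite"
  shows "cylinder n x \<in> sets bernoulli"
proof (rule ccontr)
  assume "cylinder n x \<notin> sets bernoulli"
  then have "emeasure bernoulli (cylinder n x) = 0" by (rule emeasure_notin_sets)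
  then show False
    using emeasure_bernoulli_cylinder[of n x] by (simp add: cylinder_def)
qed

lemma measure_bernoulli_cylinder:
  "measure bernoulli (cylinder n x) = 1 / real CARD('s) ^ n" for x :: "nat \<Rightarrow> 's::finite"
  using emeasure_bernoulli_cylinder[of n x] by (simp add: cylinder_def measure_def)

lemma restrict_eq_sum_cylinders:
  fixes g :: "(nat \<Rightarrow> 's::finite) \<Rightarrow> real"
  shows "g (restrict x {..<n}) = (\<Sum>w\<in>words n. g w * indicator (cylinder n w) x)"
proof -
  have "(\<Sum>w\<in>words n. g w * indicator (cylinder n w) x) =
      (\<Sum>w\<in>words n. if w = restrict x {..<n} then g w else 0)"
    by (intro sum.cong refl) (auto simp flip: restrict_eq_iff_cylinder simp: indicator_def)
  then show ?thesis by simp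
qed

lemma has_bochner_integral_restrict:
  fixes g :: "(nat \<Rightarrow> 's::finite) \<Rightarrow> real"
  shows "has_bochner_integral bernoulli (\<lambda>x. g (restrict x {..<n}))
    ((\<Sum>w\<in>words n. g w) / real CARD('s) ^ n)"
proof -
  interpret prob_space "bernoulli :: (nat \<Rightarrow> 's) measure" by (rule prob_space_bernoulli)
  have "has_bochner_integral bernoulli (\<lambda>x. \<Sum>w\<in>words n. g w * indicator (cylinder n w) x)
      (\<Sum>w\<in>words n. g w * measure bernoulli (cylinder n w))"
    by (intro has_bochner_integral_sum has_bochner_integral_mult_right has_bochner_integral_real_indicator)
      (auto simp: emeasure_eq_measure)
  then show ?thesis
    by (simp add: measure_bernoulli_cylinder sum_divide_distrib flip: restrict_eq_sum_cylinders)
qed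

section \<open>From partition functions to word sums\<close>

context bounded_distortion
begin

text \<open>By continuity the ergodic sum is the pointwise limit of its values at truncations of
  \<open>x\<close>, which are step functions on cylinders.\<close>

lemma ergodic_sum_measurable:
  assumes cont: "\<And>n. seq_continuous (f n)"
  shows "ergodic_sum f N \<in> borel_measurable bernoulli"
proof (rule borel_measurable_LIMSEQ_real)
  fix x :: "nat \<Rightarrow> 's"
  have "(\<lambda>n. f k ((seq_shift ^^ k) (restrict x {..<n}))) \<longlonglongrightarrow> f k ((seq_shift ^^ k) x)" for k
  proof (rule seq_continuous_tendsto[OF card_ge cont])
    fix m
    show "\<forall>\<^sub>F n in sequentially. (seq_shift ^^ k) (restrict x {..<n}) \<in> cylinder m ((seq_shift ^^ k) x)"
      using eventually_ge_at_top[of "k + m"]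
      by eventually_elim (auto simp: cylinder_def seq_shift_funpow)
  qed
  then show "(\<lambda>n. ergodic_sum f N (restrict x {..<n})) \<longlonglongrightarrow> ergodic_sum f N x"
    unfolding ergodic_sum_def by (intro tendsto_sum)
next
  show "(\<lambda>x. ergodic_sum f N (restrict x {..<n})) \<in> borel_measurable bernoulli" for n
    by (rule borel_measurable_has_bochner_integral[OF has_bochner_integral_restrict])
qed

text \<open>Truncating \<open>x\<close> to its first \<open>n\<close> letters changes the integrand
  by at most the factor \<open>distortion t\<close>, and the truncated integrand is a step function
  with integral \<open>word_sum n t / real CARD('s) ^ n\<close>.\<close>

lemma partition_function_bounds:
  assumes cont: "\<And>n. seq_continuous (f n)"
  shows "word_sum n t / real CARD('s) ^ n \<le> distortion t * partition_function f n t"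
    and "partition_function f n t \<le> distortion t * (word_sum n t / real CARD('s) ^ n)"
proof -
  let ?F = "\<lambda>x. exp (t * ergodic_sum f n x)"
  let ?G = "\<lambda>x. exp (t * ergodic_sum f n (restrict x {..<n}))"
  have G: "has_bochner_integral bernoulli ?G (word_sum n t / real CARD('s) ^ n)"
    unfolding word_sum_def by (rule has_bochner_integral_restrict)
  have int_G: "integrable bernoulli ?G" using G by (simp add: has_bochner_integral_iff)
  have FG: "?F x \<le> distortion t * ?G x" for x
    by (rule exp_ergodic_sum_distortion) (simp add: cylinder_def)
  have GF: "?G x \<le> distortion t * ?F x" for x
    by (rule exp_ergodic_sum_distortion) simp
  have int_F: "integrable bernoulli ?F"
  proof (rule Bochner_Integration.integrable_bound)
    show "integrable bernoulli (\<lambda>x. distortion t * ?G x)" using int_G by simp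
    show "?F \<in> borel_measurable bernoulli" using ergodic_sum_measurable[OF cont] by measurable
    show "AE x in bernoulli. norm (?F x) \<le> norm (distortion t * ?G x)"
      using FG distortion_ge_1[of t] by (intro AE_I2) (simp add: abs_mult)
  qed
  have "integral\<^sup>L bernoulli ?G \<le> integral\<^sup>L bernoulli (\<lambda>x. distortion t * ?F x)"
    using int_F int_G GF by (intro integral_mono) auto
  then show "word_sum n t / real CARD('s) ^ n \<le> distortion t * partition_function f n t"
    using has_bochner_integral_integral_eq[OF G] by (simp add: partition_function_def)
  have "integral\<^sup>L bernoulli ?F \<le> integral\<^sup>L bernoulli (\<lambda>x. distortion t * ?G x)"
    using int_F int_G FG by (intro integral_mono) auto
  then show "partition_function f n t \<le> distortion t * (word_sum n t / real CARD('s) ^ n)"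
    using has_bochner_integral_integral_eq[OF G] by (simp add: partition_function_def)
qed

lemma word_sum_limit:
  assumes cont: "\<And>n. seq_continuous (f n)"
    and lim: "(\<lambda>n. ln (partition_function f n t) / real n) \<longlonglongrightarrow> p"
  shows "(\<lambda>n. ln (word_sum n t) / real n) \<longlonglongrightarrow> p + ln (real CARD('s))"
proof -
  let ?q = "real CARD('s)" and ?Z = "\<lambda>n. partition_function f n t"
  have q: "?q > 0" using card_ge by simp
  have D: "distortion t > 0" "ln (distortion t) = \<bar>t\<bar> * C" by (simp_all add: distortion_def)
  have dist: "\<bar>ln (word_sum n t) - (ln (?Z n) + real n * ln ?q)\<bar> \<le> \<bar>t\<bar> * C" for n
  proof -
    let ?W = "word_sum n t / ?q ^ n"
    have W: "?W > 0" using word_sum_pos[of n t] q by simp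
    have le: "?W \<le> distortion t * ?Z n" "?Z n \<le> distortion t * ?W"
      by (rule partition_function_bounds[OF cont])+
    then have Z: "?Z n > 0" using W D by (metis less_le_trans zero_less_mult_pos)
    have "ln ?W \<le> ln (distortion t * ?Z n)" "ln (?Z n) \<le> ln (distortion t * ?W)"
      using le W Z D by (simp_all only: ln_le_cancel_iff mult_pos_pos)
    then have "ln ?W \<le> \<bar>t\<bar> * C + ln (?Z n)" "ln (?Z n) \<le> \<bar>t\<bar> * C + ln ?W"
      using W Z D by (simp_all only: ln_mult_pos)
    moreover have "ln ?W = ln (word_sum n t) - real n * ln ?q"
      using word_sum_pos[of n t] q by (simp add: ln_div ln_realpow)
    ultimately show ?thesis by linarith
  qed
  have "(\<lambda>n. ln (word_sum n t) / real n - (ln (?Z n) / real n + ln ?q)) \<longlonglongrightarrow> 0"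
  proof (rule tendsto_rabs_zero_cancel, rule tendsto_sandwich[OF _ _ tendsto_const])
    show "(\<lambda>n. \<bar>t\<bar> * C / real n) \<longlonglongrightarrow> 0" by real_asymp
    show "\<forall>\<^sub>F n in sequentially.
        \<bar>ln (word_sum n t) / real n - (ln (?Z n) / real n + ln ?q)\<bar> \<le> \<bar>t\<bar> * C / real n"
      using eventually_gt_at_top[of 0]
    proof eventually_elim
      case (elim n)
      then have "ln (word_sum n t) / real n - (ln (?Z n) / real n + ln ?q) =
          (ln (word_sum n t) - (ln (?Z n) + real n * ln ?q)) / real n"
        by (simp add: field_simps)
      then show ?case
        using dist[of n] by (simp add: divide_right_mono)
    qed
  qed simp
  from tendsto_add[OF this tendsto_add[OF lim tendsto_const[of "ln ?q"]]]
  show ?thesis by simp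
qed

end

theorem theorem1p1:
  fixes f :: "nat \<Rightarrow> (nat \<Rightarrow> 's::finite) \<Rightarrow> real"
    and \<phi> \<psi> :: "real \<Rightarrow> real"
  assumes q: "CARD('s) \<ge> 2"
    and cont: "\<And>n. seq_continuous (f n)"
    and bdd: "bdd_above {\<bar>f n x\<bar> | n x. True}"
    and H1: "\<And>t. (\<lambda>n. ln (partition_function f n t) / real n) \<longlonglongrightarrow> \<phi> t"
    and H2: "bdd_above {\<Sum>k<N. \<bar>f k ((seq_shift ^^ k) x) - f k ((seq_shift ^^ k) y)\<bar> | N x y.
               N \<ge> 1 \<and> (\<forall>i<N. x i = y i)}"
    and psi: "\<And>t. \<psi> t = \<phi> t + ln (real CARD('s))"
  shows "(\<forall>t>0.
       - conjugate \<psi> (subdiff_max \<psi> t) / ereal (ln (real CARD('s)))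
         \<le> hausdorff_dim seq_dist (level_set f (subdiff_min \<psi> t) (subdiff_max \<psi> t)) \<and>
       hausdorff_dim seq_dist (level_set f (subdiff_min \<psi> t) (subdiff_max \<psi> t))
         \<le> packing_dim seq_dist (level_set f (subdiff_min \<psi> t) (subdiff_max \<psi> t)) \<and>
       packing_dim seq_dist (level_set f (subdiff_min \<psi> t) (subdiff_max \<psi> t))
         \<le> - conjugate \<psi> (subdiff_min \<psi> t) / ereal (ln (real CARD('s)))) \<and>
    (\<forall>t<0.
       - conjugate \<psi> (subdiff_min \<psi> t) / ereal (ln (real CARD('s)))
         \<le> hausdorff_dim seq_dist (level_set f (subdiff_min \<psi> t) (subdiff_max \<psi> t)) \<and>
       hausdorff_dim seq_dist (level_set f (subdiff_min \<psi> t) (subdiff_max \<psi> t))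
         \<le> packing_dim seq_dist (level_set f (subdiff_min \<psi> t) (subdiff_max \<psi> t)) \<and>
       packing_dim seq_dist (level_set f (subdiff_min \<psi> t) (subdiff_max \<psi> t))
         \<le> - conjugate \<psi> (subdiff_max \<psi> t) / ereal (ln (real CARD('s))))"
proof -
  obtain B where B: "\<And>N x y. N \<ge> 1 \<Longrightarrow> (\<forall>i<N. x i = y i) \<Longrightarrow>
      (\<Sum>k<N. \<bar>f k ((seq_shift ^^ k) x) - f k ((seq_shift ^^ k) y)\<bar>) \<le> B"
    using H2 unfolding bdd_above_def by blast
  \<comment> \<open>The locale also demands the bound at \<open>N = 0\<close>, which (H2) leaves
    out; hence the maximum with 0.\<close>
  interpret bounded_distortion f "max B 0"
  proof
    fix N and x y :: "nat \<Rightarrow> 's"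
    assume y: "y \<in> cylinder N x"
    show "(\<Sum>k<N. \<bar>f k ((seq_shift ^^ k) x) - f k ((seq_shift ^^ k) y)\<bar>) \<le> max B 0"
    proof (cases "N = 0")
      case False
      then show ?thesis
        using B[of N x y] y by (simp add: cylinder_def)
    qed simp
  qed (rule q)
  interpret pressure f "max B 0" \<psi>
    by unfold_locales (simp add: psi word_sum_limit[OF cont H1])
  let ?E = "\<lambda>t. level_set f (subdiff_min \<psi> t) (subdiff_max \<psi> t)"
  let ?S = "\<lambda>n x. ergodic_sum f n x / real n"
  have lnq: "ln (real CARD('s)) > 0" using q by simp
  have sub: "subdiff_min \<psi> t \<in> subdiff \<psi> t" "subdiff_max \<psi> t \<in> subdiff \<psi> t" for t
    using subdiff_eq_interval[OF convex_pressure, of t] by auto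
  have conj: "- conjugate \<psi> c / ereal (ln (real CARD('s))) = ereal ((\<psi> t - t * c) / ln (real CARD('s)))"
    if "c \<in> subdiff \<psi> t" for c t
    using lnq by (simp add: conjugate_subdiff[OF that] mult.commute)
  have above: "\<forall>\<^sub>F n in sequentially. subdiff_min \<psi> t - e < ?S n x"
    and below: "\<forall>\<^sub>F n in sequentially. ?S n x < subdiff_max \<psi> t + e"
    if "x \<in> ?E t" "e > 0" for x t e
    using that unfolding level_set_iff by blast+
  have mid: "hausdorff_dim seq_dist (?E t) \<le> packing_dim seq_dist (?E t)" for t
    by (rule hausdorff_dim_le_packing_dim[OF q])
  show ?thesis
  proof (intro conjI allI impI mid)
    \<comment> \<open>For positive \<open>t\<close> the product \<open>t * c\<close> is largest at
      the right endpoint, which gives the lower bound for the weight exponent and so the Hausdorff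
      estimate. The tolerance \<open>e / t\<close> becomes \<open>e\<close> after multiplication by
      \<open>t\<close>.\<close>
    fix t :: real assume t: "t > 0"
    show "- conjugate \<psi> (subdiff_max \<psi> t) / ereal (ln (real CARD('s))) \<le> hausdorff_dim seq_dist (?E t)"
      unfolding conj[OF sub(2)]
    proof (rule hausdorff_dim_ge[OF gibbs_null_compl_level_set])
      fix x e assume "x \<in> ?E t" "e > (0 :: real)"
      then show "\<forall>\<^sub>F n in sequentially. t * ergodic_sum f n x / real n < t * subdiff_max \<psi> t + e"
        using below[of x t "e / t"] t by (auto elim!: eventually_mono simp: field_simps)
    qed
    show "packing_dim seq_dist (?E t) \<le> - conjugate \<psi> (subdiff_min \<psi> t) / ereal (ln (real CARD('s)))"
      unfolding conj[OF sub(1)]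
    proof (rule packing_dim_le[OF subdiff_mult_le[OF sub(1)]])
      fix x e assume "x \<in> ?E t" "e > (0 :: real)"
      then show "\<forall>\<^sub>F n in sequentially. t * subdiff_min \<psi> t - e < t * ergodic_sum f n x / real n"
        using above[of x t "e / t"] t by (auto elim!: eventually_mono simp: field_simps)
    qed
  next
    \<comment> \<open>Multiplication by a negative \<open>t\<close> reverses the inequalities, so
      the two endpoints exchange roles.\<close>
    fix t :: real assume t: "t < 0"
    show "- conjugate \<psi> (subdiff_min \<psi> t) / ereal (ln (real CARD('s))) \<le> hausdorff_dim seq_dist (?E t)"
      unfolding conj[OF sub(1)]
    proof (rule hausdorff_dim_ge[OF gibbs_null_compl_level_set])
      fix x e assume "x \<in> ?E t" "e > (0 :: real)"
      then have "\<forall>\<^sub>F n in sequentially. subdiff_min \<psi> t - e / - t < ?S n x"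
        using t by (intro above) (auto simp: divide_pos_neg)
      then show "\<forall>\<^sub>F n in sequentially. t * ergodic_sum f n x / real n < t * subdiff_min \<psi> t + e"
      proof eventually_elim
        case (elim n)
        from mult_strict_left_mono_neg[OF this t] show ?case using t by (simp add: distrib_left right_diff_distrib)
      qed
    qed
    show "packing_dim seq_dist (?E t) \<le> - conjugate \<psi> (subdiff_max \<psi> t) / ereal (ln (real CARD('s)))"
      unfolding conj[OF sub(2)]
    proof (rule packing_dim_le[OF subdiff_mult_le[OF sub(2)]])
      fix x e assume "x \<in> ?E t" "e > (0 :: real)"
      then have "\<forall>\<^sub>F n in sequentially. ?S n x < subdiff_max \<psi> t + e / - t"
        using t by (intro below) (auto simp: divide_pos_neg)
      then show "\<forall>\<^sub>F n in sequentially. t * subdiff_max \<psi> t - e < t * ergodic_sum f n x / real n"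
      proof eventually_elim
        case (elim n)
        from mult_strict_left_mono_neg[OF this t] show ?case using t by (simp add: distrib_left right_diff_distrib)
      qed
    qed
  qed
qed

end
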